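(* Let $\mathcal A$ be a rank $r$ arrangement of $n$ hyperplanes in $V=\mathbb C^{r+m}$. Then, as formal power series in $z$, $$\sum_{k\ge 0}\mathrm{Hilb}(C_{\mathcal A,k};q)\,z^k=\frac{q^{n-r}}{(1-z)(1-qz)^m}\;T_{\mathcal A}\!\left(1+\frac{q}{1-qz},\frac1q\right).$$
   Context: $\mathbb C[V^*]$ denotes the algebra of polynomial functions on $V$ (symmetric algebra of $V^*$). A (central) arrangement $\mathcal A=\{H_1,\dots,H_n\}$ in $V$ is a finite list (repetitions allowed) of hyperplanes $H_i=\{x\in V: l_i(x)=0\}$ with $l_i\in V^*$; the degenerate case $l_i=0$ (a loop) is allowed. Its matroid is the linear matroid of $l_1,\dots,l_n$, with rank function $r(\cdot)$; the rank of $\mathcal A$ is $r=\dim\mathrm{span}(l_1,\dots,l_n)$. For nonzero $h\in V$, $\rho_{\mathcal A}(h)$ is the number of $i$ with $l_i(h)\neq 0$. For an integer $k\ge 0$, $C_{\mathcal A,k}$ is the space of $f\in\mathbb C[V^*]$ such that for every nonzero $h\in V$ the $(\rho_{\mathcal A}(h)+k+1)$-th power of the directional derivative along $h$ annihilates $f$; equivalently, the restriction of $f$ to every affine line of direction $h$ has degree at most $\rho_{\mathcal A}(h)+k$. It is finite-dimensional and graded by degree, and $\mathrm{Hilb}(C;q)=\sum_i \dim C_i\,q^i$. The Tutte polynomial is $T_{\mathcal A}(x,y)=\sum_{S\subseteq[n]}(x-1)^{r-r(S)}(y-1)^{|S|-r(S)}$. *)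

theory Defs
  imports
    Complex_Main
    "HOL-Library.Poly_Mapping"
    "HOL-Computational_Algebra.Computational_Algebra"
begin

text \<open>
  Vectors of \<open>\<complex>\<^sup>d\<close> and linear forms on \<open>\<complex>\<^sup>d\<close> are finitely supported maps
  \<open>nat \<Rightarrow>\<^sub>0 complex\<close> whose keys lie in \<open>{..<d}\<close> (so \<open>d = 0\<close> is covered); a linear form is given by
  its coefficients in the dual basis. Elements of \<open>\<complex>[x\<^sub>0, \<dots>, x\<^sub>d\<^sub>-\<^sub>1]\<close> are finitely supported maps
  from exponent vectors \<open>nat \<Rightarrow>\<^sub>0 nat\<close> to \<open>complex\<close>.
\<close>

type_synonym cvec = "nat \<Rightarrow>\<^sub>0 complex"
type_synonym cpoly = "(nat \<Rightarrow>\<^sub>0 nat) \<Rightarrow>\<^sub>0 complex"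

definition scale :: "complex \<Rightarrow> ('k \<Rightarrow>\<^sub>0 complex) \<Rightarrow> ('k \<Rightarrow>\<^sub>0 complex)" where
  "scale c p = Poly_Mapping.map (\<lambda>a. c * a) p"

lemma lookup_scale [simp]: "Poly_Mapping.lookup (scale c p) x = c * Poly_Mapping.lookup p x"
  by (simp add: scale_def Poly_Mapping.map.rep_eq when_def)

global_interpretation cspace: vector_space "scale :: complex \<Rightarrow> ('k \<Rightarrow>\<^sub>0 complex) \<Rightarrow> _"
  by unfold_locales
    (auto intro!: poly_mapping_eqI simp: Poly_Mapping.lookup_add algebra_simps)

definition coord_space :: "nat \<Rightarrow> cvec set" where
  "coord_space d = {v. Poly_Mapping.keys v \<subseteq> {..<d}}"

definition form_eval :: "cvec \<Rightarrow> cvec \<Rightarrow> complex" where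
  "form_eval l h = (\<Sum>i\<in>Poly_Mapping.keys l. Poly_Mapping.lookup l i * Poly_Mapping.lookup h i)"

definition poly_ring :: "nat \<Rightarrow> cpoly set" where
  "poly_ring d = {f. \<forall>e\<in>Poly_Mapping.keys f. Poly_Mapping.keys e \<subseteq> {..<d}}"

definition partial_deriv :: "nat \<Rightarrow> cpoly \<Rightarrow> cpoly" where
  "partial_deriv i f =
     (\<Sum>e\<in>Poly_Mapping.keys f.
        Poly_Mapping.single (e - Poly_Mapping.single i 1)
          (of_nat (Poly_Mapping.lookup e i) * Poly_Mapping.lookup f e))"

definition dir_deriv :: "cvec \<Rightarrow> cpoly \<Rightarrow> cpoly" where
  "dir_deriv h f = (\<Sum>i\<in>Poly_Mapping.keys h. scale (Poly_Mapping.lookup h i) (partial_deriv i f))"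

definition exp_degree :: "(nat \<Rightarrow>\<^sub>0 nat) \<Rightarrow> nat" where
  "exp_degree e = (\<Sum>i\<in>Poly_Mapping.keys e. Poly_Mapping.lookup e i)"

definition homogeneous :: "nat \<Rightarrow> cpoly \<Rightarrow> bool" where
  "homogeneous i f \<longleftrightarrow> (\<forall>e\<in>Poly_Mapping.keys f. exp_degree e = i)"

text \<open>
  An arrangement is the list of its defining linear forms (repetitions and zero forms allowed);
  subsets of the matroid's ground set are subsets of \<open>{..<length ls}\<close>.
\<close>

definition form_rank :: "cvec list \<Rightarrow> nat set \<Rightarrow> nat" where
  "form_rank ls S = cspace.dim (cspace.span ((\<lambda>i. ls ! i) ` S))"

definition arr_rank :: "cvec list \<Rightarrow> nat" where
  "arr_rank ls = form_rank ls {..<length ls}"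

definition rho :: "cvec list \<Rightarrow> cvec \<Rightarrow> nat" where
  "rho ls h = card {i. i < length ls \<and> form_eval (ls ! i) h \<noteq> 0}"

definition C_space :: "nat \<Rightarrow> cvec list \<Rightarrow> nat \<Rightarrow> cpoly set" where
  "C_space d ls k =
     {f \<in> poly_ring d. \<forall>h\<in>coord_space d. h \<noteq> 0 \<longrightarrow> (dir_deriv h ^^ (rho ls h + k + 1)) f = 0}"

definition graded_part :: "cpoly set \<Rightarrow> nat \<Rightarrow> cpoly set" where
  "graded_part C i = {f \<in> C. homogeneous i f}"

text \<open>
  \<open>Sum_any\<close> is the sum over the support of its argument; it is meaningful here because only
  finitely many graded parts of a \<open>C_space\<close> are nonzero.
\<close>

definition Hilb :: "cpoly set \<Rightarrow> int poly" where
  "Hilb C = Sum_any (\<lambda>i. monom (int (cspace.dim (graded_part C i))) i)"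

definition tutte :: "cvec list \<Rightarrow> 'a::comm_ring_1 \<Rightarrow> 'a \<Rightarrow> 'a" where
  "tutte ls x y =
     (\<Sum>S\<in>Pow {..<length ls}.
        (x - 1) ^ (arr_rank ls - form_rank ls S) * (y - 1) ^ (card S - form_rank ls S))"

text \<open>
  Power series in \<open>z\<close> over the field of rational functions in \<open>q\<close>.
\<close>

abbreviation q_var :: "int poly fract" where
  "q_var \<equiv> to_fract [:0, 1:]"

abbreviation q_ser :: "int poly fract fps" where
  "q_ser \<equiv> fps_const q_var"

abbreviation z_ser :: "int poly fract fps" where
  "z_ser \<equiv> fps_X"

end

theory Submission
  imports Defs
begin

text \<open>
  Let \<open>l\<close> be a nonzero form of the arrangement and \<open>H\<close> its hyperplane. Multiplication by \<open>l\<close> and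
  restriction to \<open>H\<close> give, in each degree, an exact sequence
  \<open>0 \<rightarrow> C(A - l, k) \<rightarrow> C(A, k) \<rightarrow> C(A / l, k) \<rightarrow> 0\<close>, where the first map raises degrees by one.
  Only surjectivity is not formal. It follows from the fact that, for \<open>k \<ge> 0\<close>, the space \<open>C(A, k)\<close> is
  spanned by the products of a polynomial of degree at most \<open>k\<close> with some of the forms: such products
  lie in \<open>C(A, k)\<close> and lift from \<open>H\<close>, and left exactness then gives the spanning property by
  induction on the number of forms. Without forms, \<open>C(A, k)\<close> consists of the polynomials of degree at
  most \<open>k\<close>, because the \<open>i\<close>-th derivative along \<open>h\<close> of a form \<open>f\<close> of degree \<open>i\<close> is \<open>i! f(h)\<close>.

  Multiplied by \<open>(1 - z)(1 - qz)\<^sup>r\<^sup>+\<^sup>m\<close>, the right-hand side of the theorem becomes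
  \<open>\<Sum>\<^sub>S q\<^bsup>n - |S|\<^esup> (1 - q)\<^bsup>|S| - r(S)\<^esup> (1 - qz)\<^bsup>r(S)\<^esup>\<close>, which obeys the same recursion.
\<close>

section \<open>Exact sequences of vector spaces\<close>

lemma (in vector_space) subspace_finite_basis:
  assumes "subspace V" "V \<subseteq> span F" "finite F"
  obtains B where "B \<subseteq> V" "independent B" "span B = V" "finite B" "card B = dim V"
proof -
  obtain B where B: "B \<subseteq> V" "independent B" "V \<subseteq> span B" "card B = dim V"
    using basis_exists by blast
  then have "finite B" using independent_span_bound[of F B] assms by auto
  moreover have "span B = V" using B assms(1) span_minimal by blast
  ultimately show ?thesis using that B by blast
qed

text \<open>The image of a basis \<open>B\<close> of \<open>V\<close> and lifts \<open>s\<close> of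
  a basis \<open>C\<close> of \<open>W\<close> together form a basis of \<open>U\<close>. Exactness
  is stated on subspaces, so that \<open>f\<close> and \<open>g\<close> may be maps of the whole
  ambient space.\<close>

lemma (in vector_space) dim_short_exact:
  assumes lf: "Vector_Spaces.linear scale scale f" and lg: "Vector_Spaces.linear scale scale g"
    and U: "subspace U" and V: "subspace V" "V \<subseteq> span F" "finite F"
    and W: "subspace W" "W \<subseteq> span F'" "finite F'"
    and fV: "\<And>v. v \<in> V \<Longrightarrow> f v \<in> U" and inj: "inj_on f V"
    and gf: "\<And>v. v \<in> V \<Longrightarrow> g (f v) = 0"
    and ker: "\<And>u. u \<in> U \<Longrightarrow> g u = 0 \<Longrightarrow> u \<in> f ` V"
    and gU: "g ` U = W"
  shows "dim U = dim V + dim W"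
proof -
  interpret f: Vector_Spaces.linear scale scale f by (fact lf)
  interpret g: Vector_Spaces.linear scale scale g by (fact lg)
  obtain B where B: "B \<subseteq> V" "independent B" "span B = V" "finite B" "card B = dim V"
    using subspace_finite_basis[OF V] by blast
  obtain C where C: "C \<subseteq> W" "independent C" "span C = W" "finite C" "card C = dim W"
    using subspace_finite_basis[OF W] by blast
  have "\<forall>c\<in>C. \<exists>u\<in>U. g u = c" using C(1) gU by blast
  then obtain s where s: "\<And>c. c \<in> C \<Longrightarrow> s c \<in> U" "\<And>c. c \<in> C \<Longrightarrow> g (s c) = c" by metis
  have indB: "independent (f ` B)"
    using B inj f.independent_injective_image by (metis)
  \<comment> \<open>Lifts are added one at a time: if \<open>s c\<close> depended on the earlier
    vectors, applying \<open>g\<close>, which kills the image of \<open>V\<close>, would make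
    \<open>c\<close> depend on \<open>C'\<close>.\<close>
  have "independent (f ` B \<union> s ` C') \<and> card (f ` B \<union> s ` C') = dim V + card C'"
    if "C' \<subseteq> C" for C'
    using finite_subset[OF that C(4)] that
  proof (induction C' rule: finite_induct)
    case empty
    have "card (f ` B) = card B"
      using inj B(1) card_image inj_on_subset by blast
    then show ?case using indB B by simp
  next
    case (insert c C')
    have notin: "s c \<notin> span (f ` B \<union> s ` C')"
    proof
      assume "s c \<in> span (f ` B \<union> s ` C')"
      then have "g (s c) \<in> span (g ` (f ` B \<union> s ` C'))"
        using g.span_image by blast
      moreover have "g ` (f ` B \<union> s ` C') \<subseteq> insert 0 C'"
        using gf s(2) insert.prems B(1) by auto
      ultimately have "c \<in> span (insert 0 C')"
        using s(2) insert.prems span_mono by (metis insert_subset subsetD)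
      then have "c \<in> span C'" by simp
      moreover have "C' \<subseteq> C - {c}" using insert by auto
      ultimately have "c \<in> span (C - {c})" using span_mono by blast
      then show False using C(2) insert.prems dependent_def by auto
    qed
    have IH: "independent (f ` B \<union> s ` C')" "card (f ` B \<union> s ` C') = dim V + card C'"
      using insert.IH insert.prems by simp_all
    have eq: "f ` B \<union> s ` insert c C' = insert (s c) (f ` B \<union> s ` C')" by simp
    have "s c \<notin> f ` B \<union> s ` C'" using notin span_base[of "s c" "f ` B \<union> s ` C'"] by (rule contrapos_nn)
    moreover have "finite (f ` B \<union> s ` C')" using B(4) insert.hyps(1) by simp
    ultimately have "card (insert (s c) (f ` B \<union> s ` C')) = dim V + card (insert c C')"
      using IH(2) insert.hyps by simp
    then show ?case
      unfolding eq using independent_insertI[OF notin IH(1)] by simp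
  qed
  then have ind: "independent (f ` B \<union> s ` C)" "card (f ` B \<union> s ` C) = dim V + dim W"
    using C(5) by auto
  have sub: "f ` B \<union> s ` C \<subseteq> U" using fV B(1) s(1) by auto
  \<comment> \<open>Subtracting from \<open>u\<close> a combination \<open>t\<close> of lifts with
    the same image under \<open>g\<close> leaves an element of the kernel, hence of the image of
    \<open>V\<close>.\<close>
  have "U \<subseteq> span (f ` B \<union> s ` C)"
  proof
    fix u assume u: "u \<in> U"
    have "g ` s ` C = C" using s(2) by force
    then have "g u \<in> span (g ` s ` C)" using u gU C(3) by auto
    then obtain t where t: "t \<in> span (s ` C)" "g u = g t" using g.span_image by auto
    have "span (s ` C) \<subseteq> U" using s(1) U span_minimal by blast
    then have "u - t \<in> U" using u t U subspace_diff by blast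
    moreover have "g (u - t) = 0" using t g.diff by simp
    ultimately obtain v where v: "v \<in> V" "u - t = f v" using ker by blast
    then have "u - t \<in> span (f ` B)" using B(3) f.span_image by auto
    then have "u - t \<in> span (f ` B \<union> s ` C)" "t \<in> span (f ` B \<union> s ` C)"
      using t span_mono by blast+
    then show "u \<in> span (f ` B \<union> s ` C)" using span_add by fastforce
  qed
  then show ?thesis using basis_card_eq_dim[OF sub _ ind(1)] ind(2) by simp
qed

section \<open>Polynomials as finitely supported maps\<close>

lemma poly_mapping_sum_single:
  "p = (\<Sum>k\<in>Poly_Mapping.keys p. Poly_Mapping.single k (Poly_Mapping.lookup p k))"
  for p :: "'a \<Rightarrow>\<^sub>0 'b::comm_monoid_add"
proof (rule poly_mapping_eqI)
  fix k
  show "Poly_Mapping.lookup p k = Poly_Mapping.lookup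
    (\<Sum>k\<in>Poly_Mapping.keys p. Poly_Mapping.single k (Poly_Mapping.lookup p k)) k"
    by (cases "k \<in> Poly_Mapping.keys p")
       (auto simp: Poly_Mapping.lookup_sum Poly_Mapping.lookup_single when_def in_keys_iff
             sum.delta')
qed

text \<open>The zero map has no case of its own: it is \<open>single k 0\<close>.\<close>

lemma poly_mapping_single_induct [case_names single add]:
  fixes p :: "'a \<Rightarrow>\<^sub>0 'b::comm_monoid_add"
  assumes "\<And>k c. P (Poly_Mapping.single k c)" and "\<And>p q. P p \<Longrightarrow> P q \<Longrightarrow> P (p + q)"
  shows "P p"
proof -
  have "P (\<Sum>k\<in>A. Poly_Mapping.single k (Poly_Mapping.lookup p k))" if "finite A" for A
    using that
  proof induction
    case empty
    show ?case using assms(1)[of _ 0] by simp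
  qed (simp add: assms)
  then show ?thesis using poly_mapping_sum_single[of p] by (metis finite_keys)
qed

definition Const :: "complex \<Rightarrow> cpoly" where "Const c = Poly_Mapping.single 0 c"

definition Var :: "nat \<Rightarrow> cpoly" where "Var x = Poly_Mapping.single (Poly_Mapping.single x 1) 1"

lemma Const_simps [simp]:
  "Const 0 = 0" "Const 1 = 1" "Const (a + b) = Const a + Const b"
  "Const (a * b) = Const a * Const b" "Const (- a) = - Const a"
  by (simp_all add: Const_def Poly_Mapping.single_add Poly_Mapping.mult_single
      Poly_Mapping.single_uminus)

lemma Const_of_nat: "Const (of_nat n) = of_nat n"
  by (simp add: Const_def)

lemma Const_eq_iff [simp]: "Const a = Const b \<longleftrightarrow> a = b"
  unfolding Const_def by (metis lookup_single_eq)

lemma Const_eq_0_iff [simp]: "Const a = 0 \<longleftrightarrow> a = 0"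
  using Const_eq_iff[of a 0] by simp

lemma scale_conv_Const: "scale c (p :: cpoly) = Const c * p"
  unfolding scale_def Const_def by (rule mult_map_scale_conv_mult)

lemma Const_times_single:
  "Const c * Poly_Mapping.single e a = Poly_Mapping.single e (c * a)"
  by (simp add: Const_def Poly_Mapping.mult_single)

section \<open>Partial and directional derivatives as derivations\<close>

lemma partial_deriv_single:
  "partial_deriv i (Poly_Mapping.single e c) =
    Poly_Mapping.single (e - Poly_Mapping.single i 1) (of_nat (Poly_Mapping.lookup e i) * c)"
  by (simp add: partial_deriv_def)

lemma partial_deriv_add: "partial_deriv i (f + g) = partial_deriv i f + partial_deriv i g"
  unfolding partial_deriv_def
  by (rule setsum_keys_plus_distrib) (simp_all add: algebra_simps Poly_Mapping.single_add)

text \<open>Subtraction of exponents truncates at 0, so the shift commutes with adding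
  \<open>e'\<close> only when \<open>x_i\<close> really occurs in \<open>e\<close>.\<close>

lemma exponent_minus_single_add:
  fixes e e' :: "nat \<Rightarrow>\<^sub>0 nat"
  assumes "Poly_Mapping.lookup e i \<noteq> 0"
  shows "e + e' - Poly_Mapping.single i 1 = (e - Poly_Mapping.single i 1) + e'"
  using assms
  by (intro poly_mapping_eqI)
     (auto simp: Poly_Mapping.lookup_add Poly_Mapping.lookup_minus Poly_Mapping.lookup_single when_def)

lemma partial_deriv_mult_single:
  "partial_deriv i (Poly_Mapping.single e a * Poly_Mapping.single e' b) =
    partial_deriv i (Poly_Mapping.single e a) * Poly_Mapping.single e' b +
    Poly_Mapping.single e a * partial_deriv i (Poly_Mapping.single e' b)"
proof -
  \<comment> \<open>If \<open>x_i\<close> does not occur in \<open>e\<close>, the exponents on the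
    two sides may differ, but then both coefficients vanish.\<close>
  have 1: "partial_deriv i (Poly_Mapping.single e a) * Poly_Mapping.single e' b =
    Poly_Mapping.single (e + e' - Poly_Mapping.single i 1)
      (of_nat (Poly_Mapping.lookup e i) * (a * b))" for e e' a b
    by (cases "Poly_Mapping.lookup e i = 0")
       (simp_all add: partial_deriv_single Poly_Mapping.mult_single exponent_minus_single_add
          mult.assoc del: One_nat_def)
  have "Poly_Mapping.single e a * partial_deriv i (Poly_Mapping.single e' b) =
    Poly_Mapping.single (e + e' - Poly_Mapping.single i 1)
      (of_nat (Poly_Mapping.lookup e' i) * (a * b))"
    using 1[of e' b e a] by (simp add: mult.commute add.commute)
  then show ?thesis
    unfolding 1 by (simp add: partial_deriv_single Poly_Mapping.mult_single
        Poly_Mapping.lookup_add distrib_right Poly_Mapping.single_add)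
qed

lemma partial_deriv_mult:
  "partial_deriv i (f * g) = partial_deriv i f * g + f * partial_deriv i g"
proof (induction f rule: poly_mapping_single_induct)
  case (single e a)
  show ?case
    by (induction g rule: poly_mapping_single_induct)
       (simp_all only: partial_deriv_mult_single distrib_left partial_deriv_add add_ac)
next
  case (add f f')
  then show ?case by (simp add: distrib_right partial_deriv_add add_ac)
qed

lemma dir_deriv_add: "dir_deriv h (f + g) = dir_deriv h f + dir_deriv h g"
  by (simp add: dir_deriv_def partial_deriv_add cspace.scale_right_distrib sum.distrib)

lemma dir_deriv_mult: "dir_deriv h (f * g) = dir_deriv h f * g + f * dir_deriv h g"
  by (simp add: dir_deriv_def partial_deriv_mult scale_conv_Const distrib_left sum.distrib
      sum_distrib_left sum_distrib_right mult_ac)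

lemma dir_deriv_Const [simp]: "dir_deriv h (Const c) = 0"
  by (simp add: dir_deriv_def Const_def partial_deriv_single)

lemma dir_deriv_of_nat [simp]: "dir_deriv h (of_nat n) = 0"
  using dir_deriv_Const[of h "of_nat n"] by (simp only: Const_of_nat)

lemma dir_deriv_0 [simp]: "dir_deriv h 0 = 0"
  using dir_deriv_Const[of h 0] by simp

lemma dir_deriv_Var [simp]: "dir_deriv h (Var x) = Const (Poly_Mapping.lookup h x)"
proof -
  have "partial_deriv i (Var x) = (if i = x then 1 else 0)" for i
    by (auto simp: Var_def partial_deriv_single Poly_Mapping.lookup_single when_def)
  then have "dir_deriv h (Var x) =
    (\<Sum>i\<in>Poly_Mapping.keys h. if i = x then Const (Poly_Mapping.lookup h x) else 0)"
    unfolding dir_deriv_def by (intro sum.cong) (auto simp: scale_conv_Const)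
  then show ?thesis by (simp add: in_keys_iff)
qed

lemma dir_deriv_pow_add:
  "(dir_deriv h ^^ N) (f + g) = (dir_deriv h ^^ N) f + (dir_deriv h ^^ N) g"
  by (induction N) (simp_all add: dir_deriv_add)

lemma dir_deriv_pow_0 [simp]: "(dir_deriv h ^^ N) 0 = 0"
  by (induction N) simp_all

lemma dir_deriv_pow_Const_mult:
  "(dir_deriv h ^^ N) (Const c * f) = Const c * (dir_deriv h ^^ N) f"
  by (induction N) (simp_all add: dir_deriv_mult)

lemma dir_deriv_pow_eq_0_mono:
  assumes "(dir_deriv h ^^ N) f = 0" "N \<le> M"
  shows "(dir_deriv h ^^ M) f = 0"
proof -
  have "(dir_deriv h ^^ M) f = (dir_deriv h ^^ (M - N)) ((dir_deriv h ^^ N) f)"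
    using assms(2) by (metis comp_apply funpow_add le_add_diff_inverse2)
  then show ?thesis using assms(1) by simp
qed

text \<open>The second derivative of \<open>l\<close> along \<open>h\<close> vanishes, so the
  iterated Leibniz rule keeps only two terms.\<close>

lemma dir_deriv_pow_mult:
  assumes "dir_deriv h l = Const c"
  shows "(dir_deriv h ^^ Suc N) (l * g) =
    l * (dir_deriv h ^^ Suc N) g + of_nat (Suc N) * Const c * (dir_deriv h ^^ N) g"
proof (induction N)
  case 0
  show ?case by (simp add: dir_deriv_mult assms)
next
  case (Suc N)
  show ?case
    unfolding funpow.simps(2)[of "Suc N"] o_apply Suc
    by (simp add: dir_deriv_add dir_deriv_mult assms algebra_simps)
qed

text \<open>An inductive form of homogeneity (compare \<open>hpoly_iff\<close>): facts on
  derivatives and substitutions then follow by induction over sums and multiplication by one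
  variable. The variables form an arbitrary set \<open>X\<close> because contraction removes any one
  of them.\<close>

inductive hpoly :: "nat set \<Rightarrow> nat \<Rightarrow> cpoly \<Rightarrow> bool" for X :: "nat set" where
  zero: "hpoly X i 0"
| const: "hpoly X 0 (Const c)"
| add: "hpoly X i f \<Longrightarrow> hpoly X i g \<Longrightarrow> hpoly X i (f + g)"
| var: "x \<in> X \<Longrightarrow> hpoly X i f \<Longrightarrow> hpoly X (Suc i) (Var x * f)"

lemma hpoly_sum: "(\<And>a. a \<in> A \<Longrightarrow> hpoly X i (f a)) \<Longrightarrow> hpoly X i (sum f A)"
  by (induction A rule: infinite_finite_induct) (auto intro: hpoly.intros)

lemma exp_degree_add: "exp_degree (e + e') = exp_degree e + exp_degree e'"
  unfolding exp_degree_def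
  using setsum_keys_plus_distrib[of "\<lambda>_ v. v" e e'] by simp

lemma exp_degree_single [simp]: "exp_degree (Poly_Mapping.single x n) = n"
  by (simp add: exp_degree_def)

lemma hpoly_single:
  "Poly_Mapping.keys e \<subseteq> X \<Longrightarrow> hpoly X (exp_degree e) (Poly_Mapping.single e c)"
proof (induction "exp_degree e" arbitrary: e)
  case 0
  then have "e = 0" by (auto simp: exp_degree_def in_keys_iff intro!: poly_mapping_eqI)
  then show ?case using hpoly.const[of X c] by (simp add: exp_degree_def Const_def)
next
  case (Suc i)
  then have "e \<noteq> 0" by (auto simp: exp_degree_def)
  then obtain x where x: "x \<in> Poly_Mapping.keys e" by (metis all_not_in_conv keys_eq_empty)
  define e' where "e' = e - Poly_Mapping.single x 1"
  have e: "e = Poly_Mapping.single x 1 + e'"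
    using x unfolding e'_def
    by (intro poly_mapping_eqI)
       (auto simp: Poly_Mapping.lookup_add Poly_Mapping.lookup_minus Poly_Mapping.lookup_single
         in_keys_iff when_def)
  have "Poly_Mapping.keys e' \<subseteq> Poly_Mapping.keys e"
    by (auto simp: e'_def in_keys_iff Poly_Mapping.lookup_minus)
  moreover have deg: "exp_degree e = Suc (exp_degree e')"
    by (subst e) (simp add: exp_degree_add del: One_nat_def)
  ultimately have "hpoly X (exp_degree e') (Poly_Mapping.single e' c)"
    using Suc by (metis order_trans nat.inject)
  then have "hpoly X (Suc (exp_degree e')) (Var x * Poly_Mapping.single e' c)"
    using x Suc.prems by (auto intro: hpoly.var)
  moreover have "Var x * Poly_Mapping.single e' c = Poly_Mapping.single e c"
    by (simp add: Var_def Poly_Mapping.mult_single e[symmetric] del: One_nat_def)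
  ultimately show ?case by (simp add: deg)
qed

lemma hpoly_imp:
  "hpoly X i f \<Longrightarrow> \<forall>e\<in>Poly_Mapping.keys f. Poly_Mapping.keys e \<subseteq> X \<and> exp_degree e = i"
proof (induction rule: hpoly.induct)
  case (add i f g)
  then show ?case using Poly_Mapping.keys_add[of f g] by blast
next
  case (var x i f)
  have "Poly_Mapping.keys e \<subseteq> X \<and> exp_degree e = Suc i"
    if e: "e \<in> Poly_Mapping.keys (Var x * f)" for e
  proof -
    obtain e' where e': "e' \<in> Poly_Mapping.keys f" "e = Poly_Mapping.single x 1 + e'"
      using e Poly_Mapping.keys_mult[of "Var x" f] by (fastforce simp: Var_def)
    have "Poly_Mapping.keys e \<subseteq> insert x (Poly_Mapping.keys e')"
      using Poly_Mapping.keys_add[of "Poly_Mapping.single x 1" e'] e' by auto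
    then show ?thesis using e' var by (auto simp: exp_degree_add)
  qed
  then show ?case by blast
qed (auto simp: Const_def exp_degree_def)

lemma hpoly_iff:
  "hpoly X i f \<longleftrightarrow> (\<forall>e\<in>Poly_Mapping.keys f. Poly_Mapping.keys e \<subseteq> X \<and> exp_degree e = i)"
proof
  assume *: "\<forall>e\<in>Poly_Mapping.keys f. Poly_Mapping.keys e \<subseteq> X \<and> exp_degree e = i"
  have "hpoly X i (\<Sum>e\<in>Poly_Mapping.keys f. Poly_Mapping.single e (Poly_Mapping.lookup f e))"
    using * hpoly_single[of _ X] by (intro hpoly_sum) force
  then show "hpoly X i f" by (simp flip: poly_mapping_sum_single)
qed (rule hpoly_imp)

lemma hpoly_mono: "hpoly X i f \<Longrightarrow> X \<subseteq> Y \<Longrightarrow> hpoly Y i f"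
  by (auto simp: hpoly_iff)

lemma hpoly_Const_mult: "hpoly X i f \<Longrightarrow> hpoly X i (Const c * f)"
proof (induction rule: hpoly.induct)
  case (const a)
  show ?case using hpoly.const[of X "c * a"] by simp
next
  case (var x i f)
  then show ?case using hpoly.var[of x X i "Const c * f"] by (simp add: mult_ac)
qed (auto intro: hpoly.intros simp: distrib_left)

lemma hpoly_mult: "hpoly X i f \<Longrightarrow> hpoly X j g \<Longrightarrow> hpoly X (i + j) (f * g)"
proof (induction rule: hpoly.induct)
  case (var x i f)
  then show ?case by (simp add: mult.assoc hpoly.var)
qed (auto intro: hpoly.intros simp: distrib_right hpoly_Const_mult)

lemma hpoly_Var: "x \<in> X \<Longrightarrow> hpoly X 1 (Var x)"
  using hpoly.var[OF _ hpoly.const[of X 1], of x] by simp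

text \<open>Degree 0 is singled out: the derivative vanishes there, which the truncated
  \<open>i - 1\<close> would not record.\<close>

lemma hpoly_dir_deriv:
  "hpoly X i f \<Longrightarrow> if i = 0 then dir_deriv h f = 0 else hpoly X (i - 1) (dir_deriv h f)"
proof (induction rule: hpoly.induct)
  case (var x i f)
  then have "hpoly X i (Var x * dir_deriv h f)"
    using hpoly.var[of x X "i - 1"] by (cases "i = 0") (auto intro: hpoly.zero)
  then show ?case
    using var by (simp add: dir_deriv_mult hpoly.add hpoly_Const_mult)
qed (auto simp: dir_deriv_add intro: hpoly.intros)

lemma hpoly_dir_deriv_pow:
  "hpoly X i f \<Longrightarrow> \<exists>j. hpoly X j ((dir_deriv h ^^ N) f)"
proof (induction N)
  case (Suc N)
  then obtain j where "hpoly X j ((dir_deriv h ^^ N) f)" by blast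
  then show ?case using hpoly_dir_deriv[of X j "(dir_deriv h ^^ N) f" h]
    by (cases "j = 0") (auto intro: hpoly.zero)
qed auto

lemma dir_deriv_nilpotent: "hpoly X i f \<Longrightarrow> (dir_deriv h ^^ Suc i) f = 0"
proof (induction i arbitrary: f)
  case 0
  then show ?case using hpoly_dir_deriv[of X 0 f h] by simp
next
  case (Suc i)
  then show ?case using hpoly_dir_deriv[of X "Suc i" f h]
    by (simp add: funpow_Suc_right del: funpow.simps)
qed

text \<open>If \<open>M > 0\<close> is the least power of the derivative that kills
  \<open>g\<close>, then the \<open>M\<close>-th derivative of \<open>l * g\<close> is
  \<open>M * c\<close> times the \<open>(M - 1)\<close>-st of \<open>g\<close>, hence nonzero. So
  multiplication by \<open>l\<close> raises the order of nilpotency.\<close>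

lemma dir_deriv_pow_cancel:
  assumes "hpoly X i g" "dir_deriv h l = Const c" "c \<noteq> 0" "(dir_deriv h ^^ Suc N) (l * g) = 0"
  shows "(dir_deriv h ^^ N) g = 0"
proof (cases "g = 0")
  case False
  define M where "M = (LEAST M. (dir_deriv h ^^ M) g = 0)"
  have M: "(dir_deriv h ^^ M) g = 0"
    unfolding M_def by (rule LeastI[of _ "Suc i"], rule dir_deriv_nilpotent[OF assms(1)])
  then obtain M' where M': "M = Suc M'" using False by (cases M) auto
  have "(dir_deriv h ^^ M') g \<noteq> 0"
    using M' not_less_Least[of M' "\<lambda>M. (dir_deriv h ^^ M) g = 0"] unfolding M_def by simp
  then have "(dir_deriv h ^^ M) (l * g) \<noteq> 0"
    using dir_deriv_pow_mult[OF assms(2), of M' g] M assms(3)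
    unfolding M' by (simp del: of_nat_Suc funpow.simps)
  then have "\<not> Suc N \<le> M" using assms(4) dir_deriv_pow_eq_0_mono by blast
  then show ?thesis using dir_deriv_pow_eq_0_mono[OF M] by simp
qed auto

section \<open>Linear forms as polynomials\<close>

definition lin :: "cvec \<Rightarrow> cpoly" where
  "lin l = (\<Sum>x\<in>Poly_Mapping.keys l. Const (Poly_Mapping.lookup l x) * Var x)"

lemma lin_single: "lin (Poly_Mapping.single x c) = Const c * Var x"
  by (simp add: lin_def)

lemma lin_add: "lin (l + m) = lin l + lin m"
  unfolding lin_def
  by (rule setsum_keys_plus_distrib[of "\<lambda>x c. Const c * Var x"]) (simp_all add: distrib_right)

lemma scale_single: "scale c (Poly_Mapping.single x a) = Poly_Mapping.single x (c * a)"
  by (intro poly_mapping_eqI) (simp add: Poly_Mapping.lookup_single when_def)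

lemma lin_scale: "lin (scale c l) = Const c * lin l"
  by (induction l rule: poly_mapping_single_induct)
     (simp_all add: lin_add lin_single cspace.scale_right_distrib distrib_left mult.assoc
        scale_single)

lemma lin_0 [simp]: "lin 0 = 0"
  by (simp add: lin_def)

lemma lin_diff: "lin (l - m) = lin l - lin m"
  using lin_add[of "l - m" m] by simp

lemma hpoly_lin: "Poly_Mapping.keys l \<subseteq> X \<Longrightarrow> hpoly X 1 (lin l)"
  unfolding lin_def using hpoly_Var by (intro hpoly_sum hpoly_Const_mult) auto

lemma lookup_lin: "Poly_Mapping.lookup (lin l) (Poly_Mapping.single x 1) = Poly_Mapping.lookup l x"
proof (induction l rule: poly_mapping_single_induct)
  case (single k c)
  have "Poly_Mapping.single k (1::nat) = Poly_Mapping.single x 1 \<longleftrightarrow> k = x"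
    by (metis keys_single one_neq_zero singleton_inject)
  then show ?case
    by (simp add: lin_single Var_def Const_times_single Poly_Mapping.lookup_single when_def
        del: One_nat_def)
qed (simp add: lin_add Poly_Mapping.lookup_add)

lemma lin_eq_0_iff [simp]: "lin l = 0 \<longleftrightarrow> l = 0"
  by (auto intro!: poly_mapping_eqI simp: lookup_lin[symmetric])

lemma form_eval_add: "form_eval (l + m) h = form_eval l h + form_eval m h"
  unfolding form_eval_def
  by (rule setsum_keys_plus_distrib[of "\<lambda>x c. c * Poly_Mapping.lookup h x"])
     (simp_all add: distrib_right)

lemma form_eval_single [simp]:
  "form_eval (Poly_Mapping.single x c) h = c * Poly_Mapping.lookup h x"
  by (simp add: form_eval_def)

lemma form_eval_scale: "form_eval (scale c l) h = c * form_eval l h"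
  by (induction l rule: poly_mapping_single_induct)
     (simp_all add: form_eval_add scale_single cspace.scale_right_distrib distrib_left)

lemma form_eval_0 [simp]: "form_eval 0 h = 0"
  by (simp add: form_eval_def)

lemma dir_deriv_lin: "dir_deriv h (lin l) = Const (form_eval l h)"
  by (induction l rule: poly_mapping_single_induct)
     (simp_all add: lin_add lin_single dir_deriv_add dir_deriv_mult form_eval_add)

section \<open>Substitution homomorphisms\<close>

definition monomial_subst :: "(nat \<Rightarrow> cpoly) \<Rightarrow> (nat \<Rightarrow>\<^sub>0 nat) \<Rightarrow> cpoly" where
  "monomial_subst \<phi> e = (\<Prod>x\<in>Poly_Mapping.keys e. \<phi> x ^ Poly_Mapping.lookup e x)"

definition subst :: "(nat \<Rightarrow> cpoly) \<Rightarrow> cpoly \<Rightarrow> cpoly" where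
  "subst \<phi> f =
    (\<Sum>e\<in>Poly_Mapping.keys f. Const (Poly_Mapping.lookup f e) * monomial_subst \<phi> e)"

lemma monomial_subst_superset:
  assumes "finite A" "Poly_Mapping.keys e \<subseteq> A"
  shows "monomial_subst \<phi> e = (\<Prod>x\<in>A. \<phi> x ^ Poly_Mapping.lookup e x)"
  unfolding monomial_subst_def
  using assms by (intro prod.mono_neutral_left) (auto simp: in_keys_iff)

lemma monomial_subst_add: "monomial_subst \<phi> (e + e') = monomial_subst \<phi> e * monomial_subst \<phi> e'"
proof -
  define A where "A = Poly_Mapping.keys e \<union> Poly_Mapping.keys e'"
  have "finite A" "Poly_Mapping.keys e \<subseteq> A" "Poly_Mapping.keys e' \<subseteq> A"
    "Poly_Mapping.keys (e + e') \<subseteq> A"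
    using Poly_Mapping.keys_add[of e e'] by (auto simp: A_def)
  then show ?thesis
    by (simp add: monomial_subst_superset[of A] Poly_Mapping.lookup_add power_add prod.distrib)
qed

lemma subst_single: "subst \<phi> (Poly_Mapping.single e c) = Const c * monomial_subst \<phi> e"
  by (simp add: subst_def)

lemma subst_add: "subst \<phi> (f + g) = subst \<phi> f + subst \<phi> g"
  unfolding subst_def
  by (rule setsum_keys_plus_distrib[of "\<lambda>e c. Const c * monomial_subst \<phi> e"])
     (simp_all add: distrib_right)

lemma subst_mult: "subst \<phi> (f * g) = subst \<phi> f * subst \<phi> g"
proof (induction f rule: poly_mapping_single_induct)
  case (single e a)
  show ?case
  proof (induction g rule: poly_mapping_single_induct)
    case (single e' b)
    show ?case by (simp add: Poly_Mapping.mult_single subst_single monomial_subst_add mult_ac)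
  qed (simp add: distrib_left subst_add)
next
  case (add f f')
  then show ?case by (simp add: distrib_right subst_add)
qed

lemma subst_Const [simp]: "subst \<phi> (Const c) = Const c"
  using subst_single[of \<phi> 0 c] by (simp add: monomial_subst_def flip: Const_def)

lemma subst_0 [simp]: "subst \<phi> 0 = 0"
  using subst_Const[of \<phi> 0] by simp

lemma subst_Var [simp]: "subst \<phi> (Var x) = \<phi> x"
  by (simp add: Var_def subst_single monomial_subst_def)

lemma subst_diff: "subst \<phi> (f - g) = subst \<phi> f - subst \<phi> g"
  using subst_add[of \<phi> "f - g" g] by simp

lemma subst_id:
  "hpoly X i f \<Longrightarrow> (\<And>x. x \<in> X \<Longrightarrow> \<phi> x = Var x) \<Longrightarrow> subst \<phi> f = f"
  by (induction rule: hpoly.induct) (simp_all add: subst_add subst_mult)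

lemma hpoly_subst:
  "hpoly X i f \<Longrightarrow> (\<And>x. x \<in> X \<Longrightarrow> hpoly Y 1 (\<phi> x)) \<Longrightarrow> hpoly Y i (subst \<phi> f)"
proof (induction rule: hpoly.induct)
  case (var x i f)
  then show ?case using hpoly_mult[of Y 1 "\<phi> x" i "subst \<phi> f"] by (simp add: subst_mult)
qed (auto intro: hpoly.intros simp: subst_add)

text \<open>Chain rule. The hypothesis says that the substitution carries the direction
  \<open>h'\<close> to \<open>h\<close>; it suffices to know this on the variables in
  \<open>X\<close>.\<close>

lemma subst_dir_deriv:
  assumes "hpoly X i f" "\<And>x. x \<in> X \<Longrightarrow> dir_deriv h' (\<phi> x) = Const (Poly_Mapping.lookup h x)"
  shows "subst \<phi> (dir_deriv h f) = dir_deriv h' (subst \<phi> f)"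
  using assms(1)
  by (induction rule: hpoly.induct)
     (simp_all add: subst_add subst_mult dir_deriv_add dir_deriv_mult assms(2))

lemma subst_dir_deriv_pow:
  assumes "hpoly X i f" "\<And>x. x \<in> X \<Longrightarrow> dir_deriv h' (\<phi> x) = Const (Poly_Mapping.lookup h x)"
  shows "subst \<phi> ((dir_deriv h ^^ N) f) = (dir_deriv h' ^^ N) (subst \<phi> f)"
proof (induction N)
  case (Suc N)
  obtain j where "hpoly X j ((dir_deriv h ^^ N) f)" using hpoly_dir_deriv_pow[OF assms(1)] by blast
  from subst_dir_deriv[OF this assms(2)] show ?case using Suc by simp
qed auto

section \<open>Evaluation at a point\<close>

definition eval_at :: "cvec \<Rightarrow> cpoly \<Rightarrow> cpoly" where
  "eval_at h = subst (\<lambda>x. Const (Poly_Mapping.lookup h x))"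

text \<open>Euler's identity at the point \<open>h\<close>. Values are kept as constant polynomials,
  so that evaluation is a substitution.\<close>

lemma eval_at_dir_deriv: "hpoly X i f \<Longrightarrow> eval_at h (dir_deriv h f) = of_nat i * eval_at h f"
  by (induction rule: hpoly.induct)
     (simp_all add: eval_at_def subst_add subst_mult dir_deriv_add dir_deriv_mult algebra_simps)

text \<open>By iterated Euler's identity, the \<open>N\<close>-th derivative takes at
  \<open>h\<close> the value \<open>i (i - 1) ... (i - N + 1) f(h)\<close>, and this factor is
  nonzero for \<open>N\<close> at most \<open>i\<close>.\<close>

lemma eval_at_eq_0:
  assumes "hpoly X i f" "(dir_deriv h ^^ N) f = 0" "N \<le> i"
  shows "eval_at h f = 0"
  using assms
proof (induction N arbitrary: i f)
  case 0
  then show ?case by (simp add: eval_at_def)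
next
  case (Suc N)
  have "hpoly X (i - 1) (dir_deriv h f)" using hpoly_dir_deriv[OF Suc.prems(1), of h] Suc.prems(3) by simp
  moreover have "(dir_deriv h ^^ N) (dir_deriv h f) = 0"
    using Suc.prems(2) by (simp add: funpow_swap1)
  ultimately have "eval_at h (dir_deriv h f) = 0" using Suc.IH[of "i - 1" "dir_deriv h f"] Suc.prems(3) by simp
  then show ?case using eval_at_dir_deriv[OF Suc.prems(1), of h] Suc.prems(3) by simp
qed

lemma subst_cong:
  "hpoly X i f \<Longrightarrow> (\<And>x. x \<in> X \<Longrightarrow> \<phi> x = \<psi> x) \<Longrightarrow> subst \<phi> f = subst \<psi> f"
  by (induction rule: hpoly.induct) (simp_all add: subst_add subst_mult)

lemma subst_sum: "subst \<phi> (sum f A) = (\<Sum>a\<in>A. subst \<phi> (f a))"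
  by (induction A rule: infinite_finite_induct) (simp_all add: subst_add)

lemma subst_power: "subst \<phi> (f ^ n) = subst \<phi> f ^ n"
  using subst_Const[of \<phi> 1] by (induction n) (simp_all add: subst_mult)

lemma eval_at_is_Const: "hpoly X i f \<Longrightarrow> \<exists>c. eval_at h f = Const c"
proof (induction rule: hpoly.induct)
  case (zero i)
  show ?case by (intro exI[of _ 0]) (simp add: eval_at_def)
next
  case (add i f g)
  then obtain a b where "eval_at h f = Const a" "eval_at h g = Const b" by blast
  then show ?case by (intro exI[of _ "a + b"]) (simp add: eval_at_def subst_add)
next
  case (var x i f)
  then obtain a where "eval_at h f = Const a" by blast
  then show ?case
    by (intro exI[of _ "Poly_Mapping.lookup h x * a"]) (simp add: eval_at_def subst_mult)
qed (auto simp: eval_at_def)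

text \<open>Expansion in powers of \<open>x\<close> with coefficients in the other variables;
  \<open>i - n\<close> truncates only for \<open>n > i\<close>, outside the sum.\<close>

lemma hpoly_expand_var:
  "hpoly (insert x X) i f \<Longrightarrow>
    \<exists>g. (\<forall>n. hpoly X (i - n) (g n)) \<and> f = (\<Sum>n\<le>i. Var x ^ n * g n)"
proof (induction rule: hpoly.induct)
  case (zero i)
  show ?case by (intro exI[of _ "\<lambda>_. 0"]) (auto intro: hpoly.zero)
next
  case (const c)
  show ?case by (intro exI[of _ "\<lambda>_. Const c"]) (auto intro: hpoly.const)
next
  case (add i f f')
  then obtain g g' where "\<And>n. hpoly X (i - n) (g n)" "f = (\<Sum>n\<le>i. Var x ^ n * g n)"
    "\<And>n. hpoly X (i - n) (g' n)" "f' = (\<Sum>n\<le>i. Var x ^ n * g' n)" by blast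
  then show ?case
    by (intro exI[of _ "\<lambda>n. g n + g' n"]) (auto intro: hpoly.add simp: distrib_left sum.distrib)
next
  case (var y i f)
  then obtain g where g: "\<And>n. hpoly X (i - n) (g n)" "f = (\<Sum>n\<le>i. Var x ^ n * g n)" by blast
  show ?case
  proof (cases "y = x")
    case True
    define g' where "g' n = (if n = 0 then 0 else g (n - 1))" for n
    have "hpoly X (Suc i - n) (g' n)" for n
      using g(1)[of "n - 1"] by (cases n) (auto simp: g'_def intro: hpoly.zero)
    moreover have "Var y * f = (\<Sum>n\<le>Suc i. Var x ^ n * g' n)"
      unfolding True by (subst sum.atMost_Suc_shift)
        (simp add: g'_def g(2) sum_distrib_left mult_ac)
    ultimately show ?thesis by blast
  next
    case False
    then have y: "y \<in> X" using var by simp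
    \<comment> \<open>The cut at \<open>n \<le> i\<close> removes the new summand
      \<open>n = Suc i\<close> and keeps the degree equation \<open>Suc i - n = Suc (i - n)\<close>
      valid.\<close>
    define g' where "g' n = (if n \<le> i then Var y * g n else 0)" for n
    have "hpoly X (Suc i - n) (g' n)" for n
      using hpoly.var[OF y g(1)[of n]] by (auto simp: g'_def Suc_diff_le intro: hpoly.zero)
    moreover have "Var y * f = (\<Sum>n\<le>Suc i. Var x ^ n * g' n)"
      by (simp add: g'_def g(2) sum_distrib_left mult_ac)
    ultimately show ?thesis by blast
  qed
qed

text \<open>Induction on the variables: with the others fixed at \<open>h\<close>, the expansion in
  \<open>x\<close> is a univariate polynomial vanishing at every \<open>t\<close>, so each
  coefficient vanishes at \<open>h\<close>.\<close>

lemma hpoly_eq_0I: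
  assumes "finite X" "hpoly X i f" "\<And>h. Poly_Mapping.keys h \<subseteq> X \<Longrightarrow> eval_at h f = 0"
  shows "f = 0"
  using assms
proof (induction X arbitrary: i f rule: finite_induct)
  case empty
  have "hpoly {} j g \<Longrightarrow> \<exists>c. g = Const c" for j g
  proof (induction rule: hpoly.induct)
    case (zero i)
    show ?case by (intro exI[of _ 0]) simp
  next
    case (add i f g)
    then show ?case by (metis Const_simps(3))
  qed auto
  then obtain c where "f = Const c" using empty by blast
  then show ?case using empty(2)[of 0] by (simp add: eval_at_def)
next
  case (insert x X)
  obtain g where g: "\<And>n. hpoly X (i - n) (g n)" "f = (\<Sum>n\<le>i. Var x ^ n * g n)"
    using hpoly_expand_var[OF insert.prems(1)] by blast
  have "g n = 0" if n: "n \<le> i" for n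
  proof (rule insert.IH[OF g(1)])
    fix h :: cvec
    assume h: "Poly_Mapping.keys h \<subseteq> X"
    have "\<forall>n. \<exists>c. eval_at h (g n) = Const c" using eval_at_is_Const[OF g(1)] by blast
    then obtain c where c: "\<And>n. eval_at h (g n) = Const (c n)" by metis
    have "(\<Sum>n\<le>i. c n * t ^ n) = 0" for t
    proof -
      define h' where "h' = h + Poly_Mapping.single x t"
      have "Poly_Mapping.keys h' \<subseteq> insert x X"
        using h Poly_Mapping.keys_add[of h "Poly_Mapping.single x t"]
        by (auto simp: h'_def split: if_splits)
      then have "eval_at h' f = 0" by (rule insert.prems(2))
      moreover have "eval_at h' (g n) = Const (c n)" for n
        unfolding c[symmetric] eval_at_def
        using insert.hyps(2)
        by (intro subst_cong[OF g(1)])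
           (auto simp: h'_def Poly_Mapping.lookup_add Poly_Mapping.lookup_single when_def)
      moreover have "Poly_Mapping.lookup h' x = t"
        using h insert.hyps(2)
        by (auto simp: h'_def Poly_Mapping.lookup_add in_keys_iff)
      moreover have "Const (t ^ n) = Const t ^ n" for n by (induction n) simp_all
      moreover have "Const (sum u A) = (\<Sum>a\<in>A. Const (u a))" for u :: "nat \<Rightarrow> complex" and A
        by (induction A rule: infinite_finite_induct) simp_all
      ultimately have "Const (\<Sum>n\<le>i. c n * t ^ n) = 0"
        unfolding g(2) by (simp add: eval_at_def subst_sum subst_mult subst_power mult.commute)
      then show ?thesis by simp
    qed
    then have "\<forall>n\<le>i. c n = 0" by (subst polyfun_eq_0[symmetric]) blast
    then show "eval_at h (g n) = 0" using c n by simp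
  qed
  then show ?case using g(2) by simp
qed

section \<open>The graded pieces and their product generators\<close>

text \<open>Graded parts over an arbitrary coordinate set \<open>X\<close>, since a hyperplane is
  parametrised by dropping a coordinate that need not be the last.\<close>

definition Cgr :: "nat set \<Rightarrow> cvec list \<Rightarrow> nat \<Rightarrow> nat \<Rightarrow> cpoly set" where
  "Cgr X ls k i = {f. hpoly X i f \<and>
    (\<forall>h. Poly_Mapping.keys h \<subseteq> X \<longrightarrow> h \<noteq> 0 \<longrightarrow> (dir_deriv h ^^ (rho ls h + k + 1)) f = 0)}"

lemma graded_part_C_space: "graded_part (C_space d ls k) i = Cgr {..<d} ls k i"
  by (auto simp: graded_part_def C_space_def Cgr_def hpoly_iff homogeneous_def poly_ring_def
      coord_space_def)

lemma CgrD:
  "f \<in> Cgr X ls k i \<Longrightarrow> Poly_Mapping.keys h \<subseteq> X \<Longrightarrow> h \<noteq> 0 \<Longrightarrow>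
    (dir_deriv h ^^ Suc (rho ls h + k)) f = 0"
  by (simp add: Cgr_def)

lemma Cgr_hpoly: "f \<in> Cgr X ls k i \<Longrightarrow> hpoly X i f"
  by (simp add: Cgr_def)

lemma CgrI:
  "hpoly X i f \<Longrightarrow> (\<And>h. Poly_Mapping.keys h \<subseteq> X \<Longrightarrow> h \<noteq> 0 \<Longrightarrow>
    (dir_deriv h ^^ Suc (rho ls h + k)) f = 0) \<Longrightarrow> f \<in> Cgr X ls k i"
  by (simp add: Cgr_def)

lemma subspace_Cgr: "cspace.subspace (Cgr X ls k i)"
  unfolding cspace.subspace_def Cgr_def
  by (simp add: hpoly.zero hpoly.add hpoly_Const_mult scale_conv_Const dir_deriv_pow_add
      dir_deriv_pow_Const_mult del: funpow.simps)

lemma zero_in_Cgr: "0 \<in> Cgr X ls k i"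
  using subspace_Cgr by (rule cspace.subspace_0)

lemma rho_conv_filter: "rho ls h = length (filter (\<lambda>l. form_eval l h \<noteq> 0) ls)"
  by (simp add: rho_def length_filter_conv_card)

lemma rho_Cons: "rho (l # ls) h = (if form_eval l h = 0 then rho ls h else Suc (rho ls h))"
  by (simp add: rho_conv_filter)

lemma Cgr_Cons:
  assumes "f \<in> Cgr X ls k i"
  shows "f \<in> Cgr X (l # ls) k i"
proof (rule CgrI)
  fix h :: cvec
  assume "Poly_Mapping.keys h \<subseteq> X" "h \<noteq> 0"
  with assms have "(dir_deriv h ^^ Suc (rho ls h + k)) f = 0" by (rule CgrD)
  then show "(dir_deriv h ^^ Suc (rho (l # ls) h + k)) f = 0"
    by (rule dir_deriv_pow_eq_0_mono) (simp add: rho_Cons)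
qed (rule Cgr_hpoly[OF assms])

text \<open>For \<open>h\<close> on the hyperplane, \<open>l\<close> commutes with the derivative;
  off it, the additional derivative allowed by \<open>rho\<close> kills both Leibniz terms.\<close>

lemma lin_mult_Cgr:
  assumes f: "f \<in> Cgr X ls k i" and l: "Poly_Mapping.keys l \<subseteq> X"
  shows "lin l * f \<in> Cgr X (l # ls) k (Suc i)"
proof (rule CgrI)
  show "hpoly X (Suc i) (lin l * f)"
    using hpoly_mult[OF hpoly_lin[OF l] Cgr_hpoly[OF f]] by simp
  fix h :: cvec
  assume h: "Poly_Mapping.keys h \<subseteq> X" "h \<noteq> 0"
  have 0: "(dir_deriv h ^^ Suc (rho ls h + k)) f = 0" using f h by (rule CgrD)
  have 1: "(dir_deriv h ^^ Suc (Suc (rho ls h + k))) f = 0"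
    using 0 by (rule dir_deriv_pow_eq_0_mono) simp
  show "(dir_deriv h ^^ Suc (rho (l # ls) h + k)) (lin l * f) = 0"
    using dir_deriv_pow_mult[OF dir_deriv_lin[of h l], where g = f] 0 1
    by (simp add: rho_Cons del: funpow.simps)
qed

text \<open>On the hyperplane the nonzero factor \<open>l\<close> cancels because polynomials form a
  domain; off it, \<open>dir_deriv_pow_cancel\<close> removes one derivative together with
  \<open>l\<close>.\<close>

lemma lin_cancel_Cgr:
  assumes f: "lin l * f \<in> Cgr X (l # ls) k (Suc i)" and "hpoly X i f" "l \<noteq> 0"
  shows "f \<in> Cgr X ls k i"
proof (rule CgrI)
  fix h :: cvec
  assume h: "Poly_Mapping.keys h \<subseteq> X" "h \<noteq> 0"
  have 0: "(dir_deriv h ^^ Suc (rho (l # ls) h + k)) (lin l * f) = 0"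
    using f h by (rule CgrD)
  show "(dir_deriv h ^^ Suc (rho ls h + k)) f = 0"
  proof (cases "form_eval l h = 0")
    case True
    then show ?thesis
      using 0 dir_deriv_pow_mult[OF dir_deriv_lin[of h l], where g = f] \<open>l \<noteq> 0\<close>
      by (simp add: rho_Cons del: funpow.simps)
  next
    case False
    with 0 have "(dir_deriv h ^^ Suc (Suc (rho ls h + k))) (lin l * f) = 0"
      by (simp add: rho_Cons)
    from dir_deriv_pow_cancel[OF assms(2) dir_deriv_lin False this] show ?thesis .
  qed
qed fact

text \<open>
  The degree \<open>i\<close> part of the span of the products of a polynomial of degree at most \<open>k\<close> with the
  linear forms indexed by a subset of the arrangement.
\<close>

fun prod_space :: "nat set \<Rightarrow> nat \<Rightarrow> cvec list \<Rightarrow> nat \<Rightarrow> cpoly set" where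
  "prod_space X k [] i = {f. hpoly X i f \<and> (i \<le> k \<or> f = 0)}"
| "prod_space X k (l # ls) i = {a + lin l * b | a b. a \<in> prod_space X k ls i \<and>
    (if i = 0 then b = 0 else b \<in> prod_space X k ls (i - 1))}"

lemma zero_in_prod_space: "0 \<in> prod_space X k ls i"
proof (induction ls arbitrary: i)
  case (Cons l ls)
  then show ?case by (auto intro!: exI[of _ 0])
qed (simp add: hpoly.zero)

lemma prod_space_ConsI:
  "a \<in> prod_space X k ls i \<Longrightarrow> if i = 0 then b = 0 else b \<in> prod_space X k ls (i - 1) \<Longrightarrow>
    a + lin l * b \<in> prod_space X k (l # ls) i"
  unfolding prod_space.simps by blast

lemma prod_space_Cons: "f \<in> prod_space X k ls i \<Longrightarrow> f \<in> prod_space X k (l # ls) i"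
  using prod_space_ConsI[of f X k ls i 0] zero_in_prod_space by simp

lemma prod_space_subset_Cgr:
  "\<forall>l\<in>set ls. Poly_Mapping.keys l \<subseteq> X \<Longrightarrow> prod_space X k ls i \<subseteq> Cgr X ls k i"
proof (induction ls arbitrary: i)
  case Nil
  show ?case
  proof
    fix f assume f: "f \<in> prod_space X k [] i"
    show "f \<in> Cgr X [] k i"
    proof (cases "f = 0")
      case True
      then show ?thesis using zero_in_Cgr by blast
    next
      case False
      then have "hpoly X i f" "i \<le> k" using f by auto
      then show ?thesis
        by (intro CgrI dir_deriv_pow_eq_0_mono[OF dir_deriv_nilpotent]) auto
    qed
  qed
next
  case (Cons l ls)
  show ?case
  proof
    fix f assume "f \<in> prod_space X k (l # ls) i"
    then obtain a b where ab: "f = a + lin l * b" "a \<in> prod_space X k ls i"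
      "if i = 0 then b = 0 else b \<in> prod_space X k ls (i - 1)" by auto
    have "a \<in> Cgr X (l # ls) k i" using ab(2) Cons by (auto intro: Cgr_Cons)
    moreover have "lin l * b \<in> Cgr X (l # ls) k i"
    proof (cases i)
      case 0
      then show ?thesis using ab(3) zero_in_Cgr by simp
    next
      case (Suc i')
      then have "b \<in> Cgr X ls k i'" using ab(3) Cons by auto
      then show ?thesis using lin_mult_Cgr Cons.prems Suc by auto
    qed
    ultimately show "f \<in> Cgr X (l # ls) k i"
      unfolding ab(1) by (rule cspace.subspace_add[OF subspace_Cgr])
  qed
qed

text \<open>Each generating product has at most \<open>length ls\<close> linear factors. Through
  \<open>Cgr_eq_prod_space\<close> this bounds the degrees occurring in \<open>Cgr\<close>.\<close>

lemma prod_space_degree: "f \<in> prod_space X k ls i \<Longrightarrow> k + length ls < i \<Longrightarrow> f = 0"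
proof (induction ls arbitrary: f i)
  case (Cons l ls)
  then obtain a b where ab: "f = a + lin l * b" "a \<in> prod_space X k ls i"
    "b \<in> prod_space X k ls (i - 1)" by auto
  then show ?case using Cons.IH[of a i] Cons.IH[of b "i - 1"] Cons.prems by simp
qed auto

section \<open>Contraction\<close>

text \<open>
  The hyperplane \<open>l = 0\<close> is parametrised by the coordinates other than \<open>x\<^sub>j\<close>, where the \<open>j\<close>-th
  coefficient of \<open>l\<close> is nonzero; \<open>contract j l m\<close> is the restriction of the form \<open>m\<close>, and
  \<open>restrict_to j l f\<close> that of the polynomial \<open>f\<close>.
\<close>

definition contract :: "nat \<Rightarrow> cvec \<Rightarrow> cvec \<Rightarrow> cvec" where
  "contract j l m = m - scale (Poly_Mapping.lookup m j / Poly_Mapping.lookup l j) l"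

definition restrict_to :: "nat \<Rightarrow> cvec \<Rightarrow> cpoly \<Rightarrow> cpoly" where
  "restrict_to j l = subst (\<lambda>x. lin (contract j l (Poly_Mapping.single x 1)))"

lemma lookup_contract:
  "Poly_Mapping.lookup (contract j l m) x = Poly_Mapping.lookup m x -
    Poly_Mapping.lookup m j / Poly_Mapping.lookup l j * Poly_Mapping.lookup l x"
  by (simp add: contract_def Poly_Mapping.lookup_minus)

lemma contract_add: "contract j l (m + m') = contract j l m + contract j l m'"
  by (intro poly_mapping_eqI)
     (simp add: lookup_contract Poly_Mapping.lookup_add algebra_simps add_divide_distrib)

lemma contract_scale: "contract j l (scale c m) = scale c (contract j l m)"
  by (intro poly_mapping_eqI) (simp add: lookup_contract algebra_simps)

lemma contract_self: "Poly_Mapping.lookup l j \<noteq> 0 \<Longrightarrow> contract j l l = 0"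
  by (simp add: contract_def)

lemma contract_single_other: "x \<noteq> j \<Longrightarrow> contract j l (Poly_Mapping.single x c) = Poly_Mapping.single x c"
  by (intro poly_mapping_eqI) (simp add: lookup_contract Poly_Mapping.lookup_single)

lemma keys_contract:
  assumes "Poly_Mapping.lookup l j \<noteq> 0" "Poly_Mapping.keys l \<subseteq> X" "Poly_Mapping.keys m \<subseteq> X"
  shows "Poly_Mapping.keys (contract j l m) \<subseteq> X - {j}"
proof
  fix x assume "x \<in> Poly_Mapping.keys (contract j l m)"
  then have *: "Poly_Mapping.lookup (contract j l m) x \<noteq> 0" by (simp add: in_keys_iff)
  then have "x \<noteq> j" using assms(1) by (auto simp: lookup_contract)
  moreover have "x \<in> Poly_Mapping.keys l \<or> x \<in> Poly_Mapping.keys m"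
    using * by (auto simp: lookup_contract in_keys_iff)
  ultimately show "x \<in> X - {j}" using assms by blast
qed

lemma restrict_to_lin: "restrict_to j l (lin m) = lin (contract j l m)"
proof (induction m rule: poly_mapping_single_induct)
  case (single x c)
  have "contract j l (Poly_Mapping.single x c) = scale c (contract j l (Poly_Mapping.single x 1))"
    by (simp flip: contract_scale add: scale_single)
  then show ?case by (simp add: restrict_to_def lin_single subst_mult lin_scale)
qed (simp add: restrict_to_def lin_add subst_add contract_add)

lemma restrict_to_Var:
  "restrict_to j l (Var x) = Var x - Const (if x = j then 1 / Poly_Mapping.lookup l j else 0) * lin l"
  by (simp add: restrict_to_def contract_def lin_diff lin_scale lin_single
      Poly_Mapping.lookup_single when_def)

lemma hpoly_restrict_to:
  assumes "Poly_Mapping.lookup l j \<noteq> 0" "Poly_Mapping.keys l \<subseteq> X" "hpoly X i f"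
  shows "hpoly (X - {j}) i (restrict_to j l f)"
  unfolding restrict_to_def using assms
  by (intro hpoly_subst[of X] hpoly_lin keys_contract) auto

lemma restrict_to_id:
  assumes "hpoly (X - {j}) i f"
  shows "restrict_to j l f = f"
  unfolding restrict_to_def
  by (rule subst_id[OF assms]) (simp add: contract_single_other lin_single)

text \<open>The inclusion of the hyperplane, for \<open>h\<close> without \<open>j\<close>-th
  coordinate: that coordinate is recovered from the others by the contracted form of
  \<open>x_j\<close>.\<close>

definition lift_vec :: "nat \<Rightarrow> cvec \<Rightarrow> cvec \<Rightarrow> cvec" where
  "lift_vec j l h =
    h + Poly_Mapping.single j (form_eval (contract j l (Poly_Mapping.single j 1)) h)"

text \<open>Contraction is the transpose of \<open>lift_vec\<close>. With \<open>m = l\<close> this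
  places the lifted vector on the hyperplane.\<close>

lemma form_eval_lift_vec:
  assumes "Poly_Mapping.lookup h j = 0"
  shows "form_eval m (lift_vec j l h) = form_eval (contract j l m) h"
proof (induction m rule: poly_mapping_single_induct)
  case (single x c)
  show ?case
  proof (cases "x = j")
    case True
    have "contract j l (Poly_Mapping.single j c) = scale c (contract j l (Poly_Mapping.single j 1))"
      by (simp flip: contract_scale add: scale_single)
    then show ?thesis using True assms
      by (simp add: lift_vec_def Poly_Mapping.lookup_add form_eval_scale)
  next
    case False
    then show ?thesis
      by (simp add: lift_vec_def contract_single_other Poly_Mapping.lookup_add
          Poly_Mapping.lookup_single)
  qed
qed (simp add: form_eval_add contract_add)

text \<open>A direction \<open>h\<close> is lifted to \<open>h'\<close> on the hyperplane. There
  \<open>l\<close> vanishes, so \<open>rho\<close> is the same for \<open>h'\<close> as for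
  \<open>h\<close> in the contraction, and the chain rule transports the vanishing
  derivative.\<close>

lemma restrict_to_Cgr:
  assumes l: "Poly_Mapping.lookup l j \<noteq> 0" "Poly_Mapping.keys l \<subseteq> X"
    and f: "f \<in> Cgr X (l # ls) k i"
  shows "restrict_to j l f \<in> Cgr (X - {j}) (map (contract j l) ls) k i"
proof (rule CgrI)
  show "hpoly (X - {j}) i (restrict_to j l f)"
    using l Cgr_hpoly[OF f] by (rule hpoly_restrict_to)
  fix h :: cvec
  assume h: "Poly_Mapping.keys h \<subseteq> X - {j}" "h \<noteq> 0"
  have hj: "Poly_Mapping.lookup h j = 0" using h by (auto simp: in_keys_iff)
  define h' where "h' = lift_vec j l h"
  note ev = form_eval_lift_vec[OF hj, where l = l, folded h'_def]
  have jX: "j \<in> X" using l by (auto simp: in_keys_iff)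
  have "Poly_Mapping.keys h' \<subseteq> X"
    using h jX Poly_Mapping.keys_add[of h] unfolding h'_def lift_vec_def
    by (fastforce split: if_splits)
  \<comment> \<open>Lifting changes only the \<open>j\<close>-th coordinate, and that of
    \<open>h\<close> is 0.\<close>
  moreover have "h' \<noteq> 0"
  proof
    assume 0: "h' = 0"
    have "Poly_Mapping.lookup h x = 0" for x
      using 0 hj by (cases "x = j")
        (auto simp: h'_def lift_vec_def Poly_Mapping.lookup_add Poly_Mapping.lookup_single
          dest!: arg_cong[of _ _ "\<lambda>p. Poly_Mapping.lookup p x"])
    then show False using h(2) by (auto intro: poly_mapping_eqI)
  qed
  ultimately have "(dir_deriv h' ^^ Suc (rho (l # ls) h' + k)) f = 0"
    using CgrD[OF f] by blast
  moreover have "rho (l # ls) h' = rho (map (contract j l) ls) h"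
    by (simp add: rho_conv_filter filter_map ev contract_self[OF l(1)] o_def)
  moreover have "dir_deriv h (lin (contract j l (Poly_Mapping.single x 1))) =
      Const (Poly_Mapping.lookup h' x)" for x
    using ev[of "Poly_Mapping.single x 1"] by (simp add: dir_deriv_lin)
  ultimately show "(dir_deriv h ^^ Suc (rho (map (contract j l) ls) h + k)) (restrict_to j l f) = 0"
    unfolding restrict_to_def
    using subst_dir_deriv_pow[OF Cgr_hpoly[OF f],
      where h = h' and h' = h and \<phi> = "\<lambda>x. lin (contract j l (Poly_Mapping.single x 1))"
        and N = "Suc (rho (l # ls) h' + k)"]
    by (simp del: funpow.simps)
qed

text \<open>Each variable is congruent to its restriction modulo \<open>l\<close>, hence so is each
  polynomial. The quotient is homogeneous, so the kernel of restriction is multiplication by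
  \<open>l\<close> in each degree.\<close>

lemma restrict_to_division:
  assumes l: "Poly_Mapping.lookup l j \<noteq> 0" "Poly_Mapping.keys l \<subseteq> X" and f: "hpoly X i f"
  shows "\<exists>g. f = restrict_to j l f + lin l * g \<and> (if i = 0 then g = 0 else hpoly X (i - 1) g)"
  using f
proof (induction rule: hpoly.induct)
  case (zero i)
  show ?case by (intro exI[of _ 0]) (simp add: restrict_to_def hpoly.zero)
next
  case (const c)
  show ?case by (intro exI[of _ 0]) (simp add: restrict_to_def)
next
  case (add i f f')
  then obtain g g' where
    g: "f = restrict_to j l f + lin l * g" "if i = 0 then g = 0 else hpoly X (i - 1) g" and
    g': "f' = restrict_to j l f' + lin l * g'" "if i = 0 then g' = 0 else hpoly X (i - 1) g'"
    by blast
  have "restrict_to j l (f + f') + lin l * (g + g') =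
      (restrict_to j l f + lin l * g) + (restrict_to j l f' + lin l * g')"
    by (simp add: restrict_to_def subst_add distrib_left)
  then have "f + f' = restrict_to j l (f + f') + lin l * (g + g')"
    by (simp flip: g(1) g'(1))
  moreover have "if i = 0 then g + g' = 0 else hpoly X (i - 1) (g + g')"
    using g(2) g'(2) by (auto intro: hpoly.add)
  ultimately show ?case by blast
next
  case (var x i f)
  then obtain g where g: "f = restrict_to j l f + lin l * g"
    "if i = 0 then g = 0 else hpoly X (i - 1) g" by blast
  \<comment> \<open>By \<open>restrict_to_Var\<close>, \<open>x\<close> restricts to
    \<open>x - c l\<close>. Writing \<open>R\<close> for the restriction of \<open>f\<close>, one
    gets \<open>x (R + l g) = (x - c l) R + l (x g + c R)\<close>, which dictates
    \<open>g'\<close>.\<close>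
  define c where "c = Const (if x = j then 1 / Poly_Mapping.lookup l j else 0)"
  define g' where "g' = Var x * g + c * restrict_to j l f"
  have "hpoly X i (Var x * g)"
    using g(2) hpoly.var[OF var(1), of "i - 1" g] by (cases i) (auto intro: hpoly.zero)
  then have "hpoly X i g'" unfolding g'_def c_def
    using hpoly_mono[OF hpoly_restrict_to[OF l var(2)], of X]
    by (intro hpoly.add hpoly_Const_mult) auto
  moreover have "Var x * f = restrict_to j l (Var x * f) + lin l * g'"
  proof -
    have "restrict_to j l (Var x * f) = (Var x - c * lin l) * restrict_to j l f"
      using restrict_to_Var[of j l x] by (simp add: restrict_to_def subst_mult c_def)
    moreover have "Var x * f = Var x * (restrict_to j l f + lin l * g)"
      using g(1) by (rule arg_cong)
    ultimately show ?thesis by (simp only: g'_def algebra_simps)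
  qed
  ultimately show ?case by auto
qed

text \<open>Restriction fixes polynomials free of \<open>x_j\<close>, and each contracted factor
  lifts to the form it came from.\<close>

lemma prod_space_lift:
  assumes l: "Poly_Mapping.lookup l j \<noteq> 0" "Poly_Mapping.keys l \<subseteq> X"
  shows "f \<in> prod_space (X - {j}) k (map (contract j l) ls) i \<Longrightarrow>
    \<exists>g\<in>prod_space X k ls i. restrict_to j l g = f"
proof (induction ls arbitrary: i f)
  case Nil
  then show ?case using hpoly_mono[of "X - {j}" i f X] restrict_to_id by (intro bexI[of _ f]) auto
next
  case (Cons m ls)
  then obtain a b where ab: "f = a + lin (contract j l m) * b"
    "a \<in> prod_space (X - {j}) k (map (contract j l) ls) i"
    "if i = 0 then b = 0 else b \<in> prod_space (X - {j}) k (map (contract j l) ls) (i - 1)" by auto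
  obtain a' where a': "a' \<in> prod_space X k ls i" "restrict_to j l a' = a"
    using Cons.IH ab(2) by blast
  obtain b' where b': "if i = 0 then b' = 0 else b' \<in> prod_space X k ls (i - 1)"
    "restrict_to j l b' = b"
  proof (cases "i = 0")
    case True
    then show ?thesis using that[of 0] ab(3) by (simp add: restrict_to_def)
  next
    case False
    then show ?thesis using that Cons.IH[of b "i - 1"] ab(3) by auto
  qed
  have "restrict_to j l (a' + lin m * b') = f"
    using a'(2) b'(2) restrict_to_lin[of j l m] ab(1)
    by (simp add: restrict_to_def subst_add subst_mult)
  then show ?case using prod_space_ConsI[OF a'(1) b'(1)] by blast
qed

section \<open>The spanning theorem and surjectivity of restriction\<close>

lemma Cgr_Nil_degree:
  assumes "finite X" "f \<in> Cgr X [] k i" "k < i"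
  shows "f = 0"
proof (rule hpoly_eq_0I[OF assms(1) Cgr_hpoly[OF assms(2)]])
  fix h :: cvec
  assume h: "Poly_Mapping.keys h \<subseteq> X"
  show "eval_at h f = 0"
  proof (cases "h = 0")
    case False
    \<comment> \<open>Without forms \<open>rho\<close> is 0, and \<open>Suc k\<close> is at most
      \<open>i\<close>, as \<open>eval_at_eq_0\<close> demands.\<close>
    have "(dir_deriv h ^^ Suc k) f = 0" using CgrD[OF assms(2) h False] by (simp add: rho_def)
    then show ?thesis using eval_at_eq_0[OF Cgr_hpoly[OF assms(2)], where h = h and N = "Suc k"] assms(3) by simp
  next
    case True
    \<comment> \<open>The origin is not a direction, but the derivative along it is zero and the
      degree is positive.\<close>
    have "dir_deriv h f = 0" using True by (simp add: dir_deriv_def)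
    then show ?thesis using eval_at_eq_0[OF Cgr_hpoly[OF assms(2)], where h = h and N = 1] assms(3) by simp
  qed
qed

text \<open>Induction on the length, with \<open>X\<close> general, because the contracted list is
  not a tail and lives on fewer coordinates. The restriction of \<open>f\<close> is a sum of
  products and lifts to some \<open>g\<close>; then \<open>f - g\<close> is \<open>l\<close> times
  an element \<open>b\<close> of the deletion's space, to which the induction hypothesis applies
  again.\<close>

lemma Cgr_eq_prod_space:
  "finite X \<Longrightarrow> \<forall>l\<in>set ls. Poly_Mapping.keys l \<subseteq> X \<Longrightarrow> Cgr X ls k i = prod_space X k ls i"
proof (induction "length ls" arbitrary: ls X i)
  case 0
  then show ?case using Cgr_Nil_degree[of X _ k i] prod_space_subset_Cgr[of "[]" X k i]
    by (force dest: Cgr_hpoly simp: not_le)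
next
  case (Suc n)
  then obtain l ls' where ls: "ls = l # ls'" by (cases ls) auto
  have l: "Poly_Mapping.keys l \<subseteq> X" and n: "n = length ls'"
    and ls': "\<forall>m\<in>set ls'. Poly_Mapping.keys m \<subseteq> X"
    using Suc ls by auto
  note IH = Suc.hyps(1)[OF n Suc.prems(1) ls']
  have "f \<in> prod_space X k (l # ls') i" if f: "f \<in> Cgr X (l # ls') k i" for f
  proof (cases "l = 0")
    case True
    then have "f \<in> Cgr X ls' k i" using f by (simp add: Cgr_def rho_Cons)
    then show ?thesis using IH prod_space_Cons by blast
  next
    case False
    then obtain j where j: "Poly_Mapping.lookup l j \<noteq> 0" by (metis lookup_zero poly_mapping_eqI)
    have "\<forall>m\<in>set (map (contract j l) ls'). Poly_Mapping.keys m \<subseteq> X - {j}"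
      using keys_contract[OF j l] ls' by auto
    then have "Cgr (X - {j}) (map (contract j l) ls') k i =
        prod_space (X - {j}) k (map (contract j l) ls') i"
      using Suc.hyps(1)[of "map (contract j l) ls'" "X - {j}"] n Suc.prems(1) by simp
    then have "restrict_to j l f \<in> prod_space (X - {j}) k (map (contract j l) ls') i"
      using restrict_to_Cgr[OF j l f] by simp
    then obtain g where g: "g \<in> prod_space X k ls' i" "restrict_to j l g = restrict_to j l f"
      using prod_space_lift[OF j l] by blast
    have "g \<in> Cgr X (l # ls') k i" using g(1) IH Cgr_Cons by blast
    then have fg: "f - g \<in> Cgr X (l # ls') k i"
      by (rule cspace.subspace_diff[OF subspace_Cgr f])
    have "restrict_to j l (f - g) = 0" using g(2) by (simp add: restrict_to_def subst_diff)
    then obtain b where b: "f - g = lin l * b" "if i = 0 then b = 0 else hpoly X (i - 1) b"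
      using restrict_to_division[OF j l Cgr_hpoly[OF fg]] by auto
    have "if i = 0 then b = 0 else b \<in> prod_space X k ls' (i - 1)"
      using b lin_cancel_Cgr[of l b X ls' k "i - 1"] fg False IH by auto
    moreover have "f = g + lin l * b" using b(1) by (simp add: algebra_simps)
    ultimately show ?thesis using prod_space_ConsI[OF g(1)] by blast
  qed
  then show ?case using prod_space_subset_Cgr[of ls X k i] Suc.prems(2) ls by blast
qed

text \<open>Elements of the contracted space are sums of products, and these lift even to the space
  of the deletion.\<close>

lemma restrict_to_Cgr_surj:
  assumes "finite X" "Poly_Mapping.lookup l j \<noteq> 0" "\<forall>m\<in>set (l # ls). Poly_Mapping.keys m \<subseteq> X"
  shows "restrict_to j l ` Cgr X (l # ls) k i = Cgr (X - {j}) (map (contract j l) ls) k i"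
proof
  have l: "Poly_Mapping.keys l \<subseteq> X" using assms(3) by simp
  show "restrict_to j l ` Cgr X (l # ls) k i \<subseteq> Cgr (X - {j}) (map (contract j l) ls) k i"
    using restrict_to_Cgr[OF assms(2) l] by blast
  have "\<forall>m\<in>set (map (contract j l) ls). Poly_Mapping.keys m \<subseteq> X - {j}"
    using keys_contract[OF assms(2) l] assms(3) by auto
  then have "Cgr (X - {j}) (map (contract j l) ls) k i =
      prod_space (X - {j}) k (map (contract j l) ls) i"
    using assms(1) by (intro Cgr_eq_prod_space) auto
  moreover have "prod_space X k ls i \<subseteq> Cgr X (l # ls) k i"
    using prod_space_subset_Cgr[of ls X k i] assms(3) Cgr_Cons by auto
  ultimately show "Cgr (X - {j}) (map (contract j l) ls) k i \<subseteq> restrict_to j l ` Cgr X (l # ls) k i"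
    using prod_space_lift[OF assms(2) l] by blast
qed

section \<open>Dimensions of the graded pieces\<close>

lemma linear_mult: "Vector_Spaces.linear scale scale (\<lambda>f. g * f :: cpoly)"
  by unfold_locales (simp_all add: distrib_left scale_conv_Const mult_ac)

lemma linear_subst: "Vector_Spaces.linear scale scale (subst \<phi>)"
  by unfold_locales (simp_all add: subst_add scale_conv_Const subst_mult)

text \<open>Generators of degree \<open>i\<close> times each variable generate degree
  \<open>Suc i\<close>. Finite spans supply the finite bases behind
  \<open>dim_short_exact\<close>.\<close>

lemma hpoly_finite_span:
  assumes "finite X"
  shows "\<exists>F. finite F \<and> (\<forall>f. hpoly X i f \<longrightarrow> f \<in> cspace.span F)"
proof (induction i)
  case 0
  have "hpoly X j f \<Longrightarrow> j = 0 \<Longrightarrow> f \<in> cspace.span {1}" for j f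
  proof (induction rule: hpoly.induct)
    case (const c)
    have "Const c = scale c (1 :: cpoly)" by (simp add: scale_conv_Const)
    then show ?case by (metis cspace.span_base cspace.span_scale singletonI)
  qed (auto intro: cspace.span_zero cspace.span_add)
  then show ?case by (intro exI[of _ "{1}"]) auto
next
  case (Suc i)
  then obtain F where F: "finite F" "\<And>f. hpoly X i f \<Longrightarrow> f \<in> cspace.span F" by blast
  define F' where "F' = (\<Union>x\<in>X. (\<lambda>f. Var x * f) ` F)"
  have "hpoly X j f \<Longrightarrow> j = Suc i \<Longrightarrow> f \<in> cspace.span F'" for j f
  proof (induction rule: hpoly.induct)
    case (var x i' f)
    interpret m: Vector_Spaces.linear scale scale "\<lambda>f. Var x * f :: cpoly" by (rule linear_mult)
    have "f \<in> cspace.span F" using var F by simp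
    then have "Var x * f \<in> cspace.span ((\<lambda>f. Var x * f) ` F)" using m.span_image by blast
    moreover have "(\<lambda>f. Var x * f) ` F \<subseteq> F'" using var by (auto simp: F'_def)
    ultimately show ?case using cspace.span_mono by blast
  qed (auto intro: cspace.span_zero cspace.span_add)
  then show ?case using F(1) assms by (intro exI[of _ F']) (auto simp: F'_def)
qed

lemma Cgr_finite_span:
  assumes "finite X"
  obtains F where "finite F" "Cgr X ls k i \<subseteq> cspace.span F"
proof -
  obtain F where "finite F" "\<forall>f. hpoly X i f \<longrightarrow> f \<in> cspace.span F"
    using hpoly_finite_span[OF assms, of i] by blast
  moreover from this have "Cgr X ls k i \<subseteq> cspace.span F" using Cgr_hpoly by blast
  ultimately show ?thesis using that by blast
qed

lemma cspace_dim_zero: "cspace.dim {0 :: 'k \<Rightarrow>\<^sub>0 complex} = 0"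
proof -
  have "cspace.independent ({} :: ('k \<Rightarrow>\<^sub>0 complex) set)" by (rule cspace.independent_empty)
  from cspace.dim_span_eq_card_independent[OF this] show ?thesis by simp
qed

lemma dim_Cgr_Cons:
  assumes X: "finite X" and j: "Poly_Mapping.lookup l j \<noteq> 0"
    and ls: "\<forall>m\<in>set (l # ls). Poly_Mapping.keys m \<subseteq> X"
  shows "cspace.dim (Cgr X (l # ls) k i) =
    (if i = 0 then 0 else cspace.dim (Cgr X ls k (i - 1))) +
    cspace.dim (Cgr (X - {j}) (map (contract j l) ls) k i)"
proof -
  \<comment> \<open>The source of multiplication by \<open>l\<close>. In degree 0 it is the zero
    space, whereas \<open>i - 1\<close> would truncate to 0 and let in the constants.\<close>
  define V where "V = (if i = 0 then {0} else Cgr X ls k (i - 1))"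
  have l: "Poly_Mapping.keys l \<subseteq> X" and "l \<noteq> 0" using ls j by auto
  then have l0: "lin l \<noteq> 0" by simp
  obtain F where F: "finite F" "Cgr X ls k (i - 1) \<subseteq> cspace.span F"
    using Cgr_finite_span[OF X] by blast
  obtain F' where F': "finite F'" "Cgr (X - {j}) (map (contract j l) ls) k i \<subseteq> cspace.span F'"
    using Cgr_finite_span[of "X - {j}"] X by blast
  have "cspace.dim (Cgr X (l # ls) k i) =
      cspace.dim V + cspace.dim (Cgr (X - {j}) (map (contract j l) ls) k i)"
  proof (rule cspace.dim_short_exact[where f = "\<lambda>f. lin l * f" and g = "restrict_to j l"
        and F = F and F' = F'])
    show "cspace.subspace V" by (auto simp: V_def subspace_Cgr)
    show "V \<subseteq> cspace.span F" using F(2) cspace.span_zero by (auto simp: V_def)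
    show "lin l * v \<in> Cgr X (l # ls) k i" if "v \<in> V" for v
      using that lin_mult_Cgr[OF _ l, of v ls k "i - 1"] zero_in_Cgr
      by (cases i) (auto simp: V_def)
    show "inj_on (\<lambda>f. lin l * f) V" using l0 by (auto intro!: inj_onI)
    show "restrict_to j l (lin l * v) = 0" for v
      using restrict_to_lin[of j l l] contract_self[OF j] by (simp add: restrict_to_def subst_mult)
    show "u \<in> (\<lambda>f. lin l * f) ` V" if u: "u \<in> Cgr X (l # ls) k i" "restrict_to j l u = 0" for u
    proof -
      obtain b where b: "u = lin l * b" "if i = 0 then b = 0 else hpoly X (i - 1) b"
        using restrict_to_division[OF j l Cgr_hpoly[OF u(1)]] u(2) by auto
      then have "b \<in> V"
        using lin_cancel_Cgr[of l b X ls k "i - 1"] u(1) \<open>l \<noteq> 0\<close> by (auto simp: V_def)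
      then show ?thesis using b by blast
    qed
    show "restrict_to j l ` Cgr X (l # ls) k i = Cgr (X - {j}) (map (contract j l) ls) k i"
      by (rule restrict_to_Cgr_surj[OF X j ls])
  qed (use F F' in \<open>auto simp: linear_mult linear_subst restrict_to_def subspace_Cgr\<close>)
  moreover have "cspace.dim V = (if i = 0 then 0 else cspace.dim (Cgr X ls k (i - 1)))"
    by (simp add: V_def cspace_dim_zero)
  ultimately show ?thesis by simp
qed

lemma Cgr_loop: "Cgr X (0 # ls) k i = Cgr X ls k i"
  by (simp add: Cgr_def rho_Cons)

lemma Cgr_degree:
  assumes "finite X" "\<forall>m\<in>set ls. Poly_Mapping.keys m \<subseteq> X" "k + length ls < i"
  shows "Cgr X ls k i = {0}"
  using Cgr_eq_prod_space[OF assms(1,2), of k i] prod_space_degree[of _ X k ls i] assms(3)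
    zero_in_prod_space[of X k ls i] by auto

section \<open>Hilbert series\<close>

text \<open>For finite \<open>X\<close> containing the keys of all forms, the cut-off loses nothing:
  higher graded parts vanish by \<open>Cgr_degree\<close>.\<close>

definition hilb_poly :: "nat set \<Rightarrow> cvec list \<Rightarrow> nat \<Rightarrow> int poly" where
  "hilb_poly X ls k = (\<Sum>i\<le>k + length ls. monom (int (cspace.dim (Cgr X ls k i))) i)"

lemma coeff_hilb_poly:
  assumes "finite X" "\<forall>m\<in>set ls. Poly_Mapping.keys m \<subseteq> X"
  shows "coeff (hilb_poly X ls k) i = int (cspace.dim (Cgr X ls k i))"
proof -
  have "coeff (hilb_poly X ls k) i =
      (if i \<le> k + length ls then int (cspace.dim (Cgr X ls k i)) else 0)"
    by (simp add: hilb_poly_def coeff_sum)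
  then show ?thesis using Cgr_degree[OF assms, of k i] by (auto simp: cspace_dim_zero)
qed

lemma Hilb_C_space:
  assumes "set ls \<subseteq> coord_space d"
  shows "Hilb (C_space d ls k) = hilb_poly {..<d} ls k"
proof -
  have "\<forall>m\<in>set ls. Poly_Mapping.keys m \<subseteq> {..<d}" using assms by (auto simp: coord_space_def)
  then have "cspace.dim (Cgr {..<d} ls k i) = 0" if "k + length ls < i" for i
    using Cgr_degree[of "{..<d}" ls k i] that by (simp add: cspace_dim_zero)
  then have "monom (int (cspace.dim (Cgr {..<d} ls k i))) i = 0" if "i \<notin> {..k + length ls}" for i
    using that by simp
  then have "{i. monom (int (cspace.dim (Cgr {..<d} ls k i))) i \<noteq> 0} \<subseteq> {..k + length ls}"
    by blast
  then show ?thesis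
    unfolding Hilb_def hilb_poly_def graded_part_C_space
    by (intro Sum_any.expand_superset) auto
qed

lemma hilb_poly_loop: "hilb_poly X (0 # ls) k = hilb_poly X ls k"
  if "finite X" "\<forall>m\<in>set ls. Poly_Mapping.keys m \<subseteq> X"
  using that by (intro poly_eqI) (simp add: coeff_hilb_poly Cgr_loop)

lemma hilb_poly_Cons:
  assumes "finite X" "Poly_Mapping.lookup l j \<noteq> 0" "\<forall>m\<in>set (l # ls). Poly_Mapping.keys m \<subseteq> X"
  shows "hilb_poly X (l # ls) k =
    [:0, 1:] * hilb_poly X ls k + hilb_poly (X - {j}) (map (contract j l) ls) k"
proof (rule poly_eqI)
  fix i
  have c: "coeff ([:0, 1:] * p) i = (if i = 0 then 0 else coeff p (i - 1))" for p :: "int poly"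
    by (cases i) (simp_all add: coeff_pCons)
  have "\<forall>m\<in>set (map (contract j l) ls). Poly_Mapping.keys m \<subseteq> X - {j}"
    using keys_contract[OF assms(2)] assms(3) by auto
  then show "coeff (hilb_poly X (l # ls) k) i =
    coeff ([:0, 1:] * hilb_poly X ls k + hilb_poly (X - {j}) (map (contract j l) ls) k) i"
    using assms dim_Cgr_Cons[OF assms, of k i] unfolding coeff_add c
    by (simp add: coeff_hilb_poly)
qed

section \<open>The empty arrangement: polynomials of bounded degree\<close>

lemma Cgr_Nil:
  "finite X \<Longrightarrow> Cgr X [] k i = (if i \<le> k then {f. hpoly X i f} else {0})"
  using Cgr_eq_prod_space[of X "[]" k i] by (auto intro: hpoly.zero)

text \<open>Splitting off the multiples of the variable \<open>x\<close>. The exact sequence is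
  borrowed from the arrangement consisting of the single form \<open>x\<close>.\<close>

lemma hilb_poly_Nil:
  assumes "finite X" "x \<in> X"
  shows "hilb_poly X [] k =
    (if k = 0 then 0 else [:0, 1:] * hilb_poly X [] (k - 1)) + hilb_poly (X - {x}) [] k"
proof (rule poly_eqI)
  fix i
  define l :: cvec where "l = Poly_Mapping.single x 1"
  have c: "coeff ([:0, 1:] * p) i = (if i = 0 then 0 else coeff p (i - 1))" for p :: "int poly"
    by (cases i) (simp_all add: coeff_pCons)
  have "cspace.dim (Cgr X [] k i) =
    (if k = 0 \<or> i = 0 then 0 else cspace.dim (Cgr X [] (k - 1) (i - 1))) +
      cspace.dim (Cgr (X - {x}) [] k i)"
  proof (cases "i \<le> k")
    case True
    \<comment> \<open>In degrees up to \<open>k\<close> both spaces contain all homogeneous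
      polynomials, so the auxiliary form makes no difference.\<close>
    have "Cgr X [l] k i = Cgr X [] k i"
      using Cgr_Cons[of _ X "[]" k i l] Cgr_hpoly[of _ X "[l]" k i] Cgr_Nil[OF assms(1), of k i] True
      by auto
    \<comment> \<open>The quotient by \<open>x\<close> has degree \<open>i - 1\<close>, which is at
      most \<open>k - 1\<close>; so \<open>k\<close> may be lowered along with \<open>i\<close>,
      which yields the factor \<open>qz\<close>.\<close>
    moreover have "Cgr X [] k (i - 1) = Cgr X [] (k - 1) (i - 1)" if "i \<noteq> 0"
    proof -
      have "i - 1 \<le> k" "i - 1 \<le> k - 1" using True by linarith+
      then show ?thesis by (simp only: Cgr_Nil[OF assms(1)] if_True)
    qed
    ultimately show ?thesis
      using dim_Cgr_Cons[of X l x "[]" k i] assms True by (auto simp: l_def)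
  next
    case False
    then show ?thesis using assms(1) by (auto simp: Cgr_Nil cspace_dim_zero)
  qed
  then show "coeff (hilb_poly X [] k) i = coeff
    ((if k = 0 then 0 else [:0, 1:] * hilb_poly X [] (k - 1)) + hilb_poly (X - {x}) [] k) i"
    using assms c by (simp add: coeff_hilb_poly del: mult_pCons_left)
qed

lemma hilb_poly_point: "hilb_poly {} [] k = 1"
proof (rule poly_eqI)
  fix i
  have "{f. hpoly {} 0 f} = cspace.span {1 :: cpoly}"
  proof -
    have "hpoly {} 0 f \<longleftrightarrow> f \<in> range (\<lambda>c. scale c 1)" for f
    proof
      assume f: "hpoly {} 0 f"
      have "Poly_Mapping.keys f \<subseteq> {0}" using f by (auto simp: hpoly_iff)
      then have "f = scale (Poly_Mapping.lookup f 0) 1"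
        by (intro poly_mapping_eqI)
           (auto simp: Poly_Mapping.lookup_one when_def in_keys_iff)
      then show "f \<in> range (\<lambda>c. scale c 1)" by blast
    qed (auto simp: scale_conv_Const hpoly.const)
    then show ?thesis by (auto simp: cspace.span_singleton)
  qed
  moreover have "cspace.dim (cspace.span {1 :: cpoly}) = 1"
    by (subst cspace.dim_span_eq_card_independent) auto
  moreover have "{f. hpoly {} i f} = {0}" if "i > 0"
  proof -
    have "f = 0" if "hpoly {} i f" for f
    proof -
      have "e \<notin> Poly_Mapping.keys f" for e
        using that \<open>i > 0\<close> by (auto simp: hpoly_iff exp_degree_def)
      then show ?thesis by (metis all_not_in_conv keys_eq_empty)
    qed
    then show ?thesis by (auto intro: hpoly.zero)
  qed
  ultimately show "coeff (hilb_poly {} [] k) i = coeff 1 i"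
    by (auto simp: coeff_hilb_poly Cgr_Nil cspace_dim_zero)
qed

definition hilb_fps :: "nat set \<Rightarrow> cvec list \<Rightarrow> int poly fract fps" where
  "hilb_fps X ls = Abs_fps (\<lambda>k. to_fract (hilb_poly X ls k))"

text \<open>With no variables only constants remain, giving \<open>1 / (1 - z)\<close>; by
  \<open>hilb_poly_Nil\<close> each variable contributes a factor
  \<open>1 / (1 - qz)\<close>.\<close>

lemma hilb_fps_Nil:
  "finite X \<Longrightarrow> hilb_fps X [] * ((1 - z_ser) * (1 - q_ser * z_ser) ^ card X) = 1"
proof (induction X rule: finite_induct)
  case empty
  show ?case by (rule fps_ext) (simp add: hilb_fps_def hilb_poly_point right_diff_distrib
        fps_X_mult_right_nth)
next
  case (insert x X)
  have "hilb_fps (insert x X) [] = q_ser * (z_ser * hilb_fps (insert x X) []) + hilb_fps X []"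
  proof (rule fps_ext)
    fix k
    have "hilb_poly (insert x X) [] k =
      (if k = 0 then 0 else [:0, 1:] * hilb_poly (insert x X) [] (k - 1)) + hilb_poly X [] k"
      using hilb_poly_Nil[of "insert x X" x k] insert.hyps by simp
    then show "hilb_fps (insert x X) [] $ k =
        (q_ser * (z_ser * hilb_fps (insert x X) []) + hilb_fps X []) $ k"
      by (simp add: hilb_fps_def del: mult_pCons_left)
  qed
  then have "hilb_fps (insert x X) [] * (1 - q_ser * z_ser) = hilb_fps X []"
    by (simp add: algebra_simps)
  then have "hilb_fps (insert x X) [] * ((1 - z_ser) * (1 - q_ser * z_ser) ^ Suc (card X)) =
      hilb_fps X [] * ((1 - z_ser) * (1 - q_ser * z_ser) ^ card X)"
    by (simp only: power_Suc mult_ac flip: \<open>_ = hilb_fps X []\<close>)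
  then show ?case using insert by simp
qed

section \<open>Deletion and contraction for the rank generating function\<close>

text \<open>The Tutte polynomial with denominators cleared, \<open>w\<close> standing for
  \<open>1 - qz\<close>; see \<open>tutte_conv_rank_gf\<close>.\<close>

definition rank_gf :: "'a::comm_ring_1 \<Rightarrow> 'a \<Rightarrow> cvec list \<Rightarrow> 'a" where
  "rank_gf q w ls = (\<Sum>S\<in>Pow {..<length ls}.
     q ^ (length ls - card S) * (1 - q) ^ (card S - form_rank ls S) * w ^ form_rank ls S)"

lemma form_rank_le_card: "finite S \<Longrightarrow> form_rank ls S \<le> card S"
  unfolding form_rank_def
  using cspace.dim_le_card[OF order_refl, of "(\<lambda>i. ls ! i) ` S"] card_image_le[of S "\<lambda>i. ls ! i"]
  by simp

text \<open>Gives \<open>r(S) \<le> r\<close>, which makes the exponent \<open>r - r(S)\<close> of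
  the Tutte polynomial a true difference.\<close>

lemma form_rank_mono:
  assumes "S \<subseteq> T" "finite T"
  shows "form_rank ls S \<le> form_rank ls T"
proof -
  let ?V = "\<lambda>S. cspace.span ((\<lambda>i. ls ! i) ` S)"
  note basis = cspace.subspace_finite_basis[OF cspace.subspace_span subset_refl finite_imageI]
  obtain B where B: "cspace.span B = ?V T" "finite B" "card B = cspace.dim (?V T)"
    using basis[OF assms(2)] by metis
  obtain B' where B': "cspace.independent B'" "B' \<subseteq> ?V S" "card B' = cspace.dim (?V S)"
    using basis[OF finite_subset[OF assms]] by metis
  have "?V S \<subseteq> ?V T" using assms(1) by (intro cspace.span_mono) auto
  then have "card B' \<le> card B" using cspace.independent_span_bound[OF B(2) B'(1)] B(1) B'(2) by simp
  then show ?thesis using B B' by (simp add: form_rank_def)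
qed

lemma form_rank_Cons_Suc: "form_rank (l # ls) (Suc ` S) = form_rank ls S"
  by (simp add: form_rank_def image_image)

lemma form_rank_Cons_loop: "form_rank (0 # ls) (insert 0 (Suc ` S)) = form_rank ls S"
  by (simp add: form_rank_def image_image)

text \<open>Contracting changes forms by multiples of \<open>l\<close>, so the span together with
  \<open>l\<close> is unchanged. All contracted forms have \<open>j\<close>-th coefficient 0 and
  \<open>l\<close> does not, so \<open>l\<close> adds one dimension.\<close>

lemma form_rank_Cons_contract:
  assumes j: "Poly_Mapping.lookup l j \<noteq> 0" and S: "S \<subseteq> {..<length ls}"
  shows "form_rank (l # ls) (insert 0 (Suc ` S)) = Suc (form_rank (map (contract j l) ls) S)"
proof -
  define T where "T = (\<lambda>i. ls ! i) ` S"
  define T' where "T' = contract j l ` T"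
  have fin: "finite T'" using finite_subset[OF S] by (simp add: T'_def T_def)
  have T': "(\<lambda>i. map (contract j l) ls ! i) ` S = T'"
    using S by (force simp: T'_def T_def image_image)
  have "cspace.span (insert l T) = cspace.span (insert l T')"
  proof (rule cspace.span_eq[THEN iffD2], intro conjI subsetI)
    fix v assume v: "v \<in> insert l T"
    have "contract j l v + scale (Poly_Mapping.lookup v j / Poly_Mapping.lookup l j) l
        \<in> cspace.span (insert l T')" if "v \<in> T"
      using that by (intro cspace.span_add cspace.span_scale) (auto intro: cspace.span_base simp: T'_def)
    then show "v \<in> cspace.span (insert l T')"
      using v by (auto simp: contract_def intro: cspace.span_base)
  next
    fix v assume v: "v \<in> insert l T'"
    have "contract j l u \<in> cspace.span (insert l T)" if "u \<in> T" for u
      unfolding contract_def using that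
      by (intro cspace.span_diff cspace.span_scale) (auto intro: cspace.span_base)
    then show "v \<in> cspace.span (insert l T)"
      using v by (auto simp: T'_def intro: cspace.span_base)
  qed
  moreover have "cspace.dim (insert l T') = Suc (cspace.dim T')"
  proof -
    obtain B where B: "B \<subseteq> T'" "cspace.independent B" "T' \<subseteq> cspace.span B" "card B = cspace.dim T'"
      using cspace.basis_exists[of T'] by blast
    have "cspace.subspace {v :: cvec. Poly_Mapping.lookup v j = 0}"
      by (simp add: cspace.subspace_def Poly_Mapping.lookup_add)
    moreover have "B \<subseteq> {v. Poly_Mapping.lookup v j = 0}"
      using B(1) j by (auto simp: T'_def lookup_contract)
    ultimately have "cspace.span B \<subseteq> {v. Poly_Mapping.lookup v j = 0}"
      using cspace.span_minimal by blast
    then have l: "l \<notin> cspace.span B" using j by auto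
    then have "l \<notin> B" using cspace.span_base by blast
    have "insert l B \<subseteq> insert l T'" using B(1) by auto
    moreover have "insert l T' \<subseteq> cspace.span (insert l B)"
      using B(3) cspace.span_mono[of B "insert l B"] cspace.span_base[of l "insert l B"] by auto
    moreover have "cspace.independent (insert l B)" using l B(2) by (rule cspace.independent_insertI)
    ultimately have "card (insert l B) = cspace.dim (insert l T')" by (rule cspace.basis_card_eq_dim)
    then show ?thesis using \<open>l \<notin> B\<close> B fin finite_subset[OF B(1) fin] by simp
  qed
  moreover have "(\<lambda>i. (l # ls) ! i) ` insert 0 (Suc ` S) = insert l T"
    by (simp add: T_def image_image)
  ultimately show ?thesis unfolding form_rank_def T'
    by (metis cspace.dim_span)
qed

text \<open>Prepending a form shifts the old indices by \<open>Suc\<close>; the new form has index 0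
  and is either absent or present.\<close>

lemma sum_Pow_lessThan_Suc:
  "(\<Sum>S\<in>Pow {..<Suc n}. f S) =
    (\<Sum>S\<in>Pow {..<n}. f (Suc ` S)) + (\<Sum>S\<in>Pow {..<n}. f (insert 0 (Suc ` S)))"
proof -
  have inj: "inj_on (image Suc) (Pow {..<n})" by (simp add: inj_on_def inj_image_eq_iff)
  have ins: "inj_on (insert 0) (Pow (Suc ` {..<n}))" by (auto simp: inj_on_def)
  have disj: "Pow (Suc ` {..<n}) \<inter> insert 0 ` Pow (Suc ` {..<n}) = {}" by auto
  have "(\<Sum>S\<in>Pow {..<Suc n}. f S) =
    (\<Sum>S\<in>Pow (Suc ` {..<n}). f S) + (\<Sum>S\<in>insert 0 ` Pow (Suc ` {..<n}). f S)"
    unfolding lessThan_Suc_eq_insert_0 Pow_insert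
    by (rule sum.union_disjoint) (use disj in auto)
  also have "Pow (Suc ` {..<n}) = image Suc ` Pow {..<n}" by (rule image_Pow_surj[symmetric]) simp
  finally show ?thesis
    using ins unfolding image_Pow_surj[OF refl, of Suc "{..<n}", symmetric]
    by (simp add: sum.reindex inj o_def)
qed

text \<open>For subsets avoiding the new form only the size of the complement grows, by one: a
  factor \<open>q\<close>.\<close>

lemma rank_gf_deletion:
  "(\<Sum>S\<in>Pow {..<length ls}. q ^ (Suc (length ls) - card (Suc ` S)) *
    (1 - q) ^ (card (Suc ` S) - form_rank (l # ls) (Suc ` S)) * w ^ form_rank (l # ls) (Suc ` S)) =
    q * rank_gf q w ls"
  unfolding rank_gf_def sum_distrib_left
proof (rule sum.cong[OF refl])
  fix S assume "S \<in> Pow {..<length ls}"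
  then have "card S \<le> length ls" using card_mono[of "{..<length ls}" S] by simp
  then show "q ^ (Suc (length ls) - card (Suc ` S)) *
    (1 - q) ^ (card (Suc ` S) - form_rank (l # ls) (Suc ` S)) * w ^ form_rank (l # ls) (Suc ` S) =
    q * (q ^ (length ls - card S) * (1 - q) ^ (card S - form_rank ls S) * w ^ form_rank ls S)"
    by (simp add: form_rank_Cons_Suc card_image Suc_diff_le mult_ac)
qed

text \<open>A loop adds to the size of \<open>S\<close> but not to its rank, a factor
  \<open>1 - q\<close>; with the factor \<open>q\<close> of the subsets avoiding it, the total is
  1.\<close>

lemma rank_gf_loop: "rank_gf q w (0 # ls) = rank_gf q w ls"
proof -
  let ?n = "length ls"
  have "(\<Sum>S\<in>Pow {..<?n}. q ^ (Suc ?n - card (insert 0 (Suc ` S))) *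
      (1 - q) ^ (card (insert 0 (Suc ` S)) - form_rank (0 # ls) (insert 0 (Suc ` S))) *
      w ^ form_rank (0 # ls) (insert 0 (Suc ` S))) = (1 - q) * rank_gf q w ls"
    unfolding rank_gf_def sum_distrib_left
  proof (rule sum.cong[OF refl])
    fix S assume "S \<in> Pow {..<?n}"
    then have S: "finite S" using finite_subset by auto
    then have "form_rank ls S \<le> card S" by (rule form_rank_le_card)
    then show "q ^ (Suc ?n - card (insert 0 (Suc ` S))) *
      (1 - q) ^ (card (insert 0 (Suc ` S)) - form_rank (0 # ls) (insert 0 (Suc ` S))) *
      w ^ form_rank (0 # ls) (insert 0 (Suc ` S)) =
      (1 - q) * (q ^ (?n - card S) * (1 - q) ^ (card S - form_rank ls S) * w ^ form_rank ls S)"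
      using S by (simp add: form_rank_Cons_loop card_image Suc_diff_le mult_ac)
  qed
  then show ?thesis
    unfolding rank_gf_def[of q w "0 # ls"] length_Cons sum_Pow_lessThan_Suc rank_gf_deletion
    by (simp add: algebra_simps)
qed

text \<open>For subsets containing \<open>l\<close>, size and rank both exceed those in the
  contraction by one: a factor \<open>w\<close>.\<close>

lemma rank_gf_contract:
  assumes j: "Poly_Mapping.lookup l j \<noteq> 0"
  shows "rank_gf q w (l # ls) = q * rank_gf q w ls + w * rank_gf q w (map (contract j l) ls)"
proof -
  let ?n = "length ls"
  have "(\<Sum>S\<in>Pow {..<?n}. q ^ (Suc ?n - card (insert 0 (Suc ` S))) *
      (1 - q) ^ (card (insert 0 (Suc ` S)) - form_rank (l # ls) (insert 0 (Suc ` S))) *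
      w ^ form_rank (l # ls) (insert 0 (Suc ` S))) = w * rank_gf q w (map (contract j l) ls)"
    unfolding rank_gf_def sum_distrib_left length_map
  proof (rule sum.cong[OF refl])
    fix S assume "S \<in> Pow {..<?n}"
    then have S: "finite S" "S \<subseteq> {..<?n}" using finite_subset by auto
    then show "q ^ (Suc ?n - card (insert 0 (Suc ` S))) *
      (1 - q) ^ (card (insert 0 (Suc ` S)) - form_rank (l # ls) (insert 0 (Suc ` S))) *
      w ^ form_rank (l # ls) (insert 0 (Suc ` S)) =
      w * (q ^ (?n - card S) * (1 - q) ^ (card S - form_rank (map (contract j l) ls) S) *
        w ^ form_rank (map (contract j l) ls) S)"
      by (simp add: form_rank_Cons_contract[OF j] card_image mult_ac)
  qed
  then show ?thesis
    unfolding rank_gf_def[of q w "l # ls"] length_Cons sum_Pow_lessThan_Suc rank_gf_deletion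
    by simp
qed

section \<open>Matching the recursions and passing to the Tutte polynomial\<close>

lemma hilb_fps_eq_rank_gf:
  "finite X \<Longrightarrow> \<forall>m\<in>set ls. Poly_Mapping.keys m \<subseteq> X \<Longrightarrow>
    hilb_fps X ls * ((1 - z_ser) * (1 - q_ser * z_ser) ^ card X) =
    rank_gf q_ser (1 - q_ser * z_ser) ls"
proof (induction "length ls" arbitrary: ls X)
  case 0
  have "form_rank [] {} = 0" using form_rank_le_card[of "{}"] by simp
  then show ?case using 0 hilb_fps_Nil[of X] by (simp add: rank_gf_def)
next
  case (Suc n)
  then obtain l ls' where ls: "ls = l # ls'" by (cases ls) auto
  have l: "Poly_Mapping.keys l \<subseteq> X" and n: "n = length ls'"
    and ls': "\<forall>m\<in>set ls'. Poly_Mapping.keys m \<subseteq> X"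
    using Suc ls by auto
  note IH = Suc.hyps(1)[OF n Suc.prems(1) ls']
  show ?case
  proof (cases "l = 0")
    case True
    then show ?thesis using IH Suc.prems(1) ls'
      by (simp add: ls hilb_fps_def hilb_poly_loop rank_gf_loop)
  next
    case False
    then obtain j where j: "Poly_Mapping.lookup l j \<noteq> 0" by (metis lookup_zero poly_mapping_eqI)
    then have jX: "j \<in> X" using l by (auto simp: in_keys_iff)
    define ls'' where "ls'' = map (contract j l) ls'"
    have "\<forall>m\<in>set ls''. Poly_Mapping.keys m \<subseteq> X - {j}"
      using keys_contract[OF j l] ls' by (auto simp: ls''_def)
    then have IH': "hilb_fps (X - {j}) ls'' * ((1 - z_ser) * (1 - q_ser * z_ser) ^ card (X - {j})) =
        rank_gf q_ser (1 - q_ser * z_ser) ls''"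
      using Suc.prems(1) n by (intro Suc.hyps(1)) (auto simp: ls''_def)
    have rec: "hilb_fps X ls = q_ser * hilb_fps X ls' + hilb_fps (X - {j}) ls''"
    proof (rule fps_ext)
      fix k
      show "hilb_fps X ls $ k = (q_ser * hilb_fps X ls' + hilb_fps (X - {j}) ls'') $ k"
        using hilb_poly_Cons[OF Suc.prems(1) j, of ls' k] Suc.prems(2)
        by (simp add: hilb_fps_def ls ls''_def del: mult_pCons_left)
    qed
    have "card X = Suc (card (X - {j}))" using jX Suc.prems(1) by (rule card.remove[rotated])
    \<comment> \<open>The contraction lives on one coordinate fewer; the surplus factor
      \<open>1 - qz\<close> is the \<open>w\<close> of \<open>rank_gf_contract\<close>.\<close>
    then have pow: "(1 - q_ser * z_ser) ^ card X =
        (1 - q_ser * z_ser) * (1 - q_ser * z_ser) ^ card (X - {j})"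
      by (simp only: power_Suc)
    have "hilb_fps X ls * ((1 - z_ser) * (1 - q_ser * z_ser) ^ card X) =
      q_ser * (hilb_fps X ls' * ((1 - z_ser) * (1 - q_ser * z_ser) ^ card X)) +
      (1 - q_ser * z_ser) *
        (hilb_fps (X - {j}) ls'' * ((1 - z_ser) * (1 - q_ser * z_ser) ^ card (X - {j})))"
      unfolding rec distrib_right pow by (simp only: mult_ac)
    then show ?thesis unfolding IH IH' by (simp add: ls ls''_def rank_gf_contract[OF j])
  qed
qed

text \<open>The sums agree term by term: \<open>w ^ (r - s)\<close> absorbs the powers of
  \<open>v\<close>, and \<open>q * (y - 1) = 1 - q\<close> turns the nullity factor into a power of
  \<open>1 - q\<close>.\<close>

lemma tutte_conv_rank_gf:
  fixes q w v y :: "'a::comm_ring_1"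
  assumes wv: "w * v = q" and qy: "q * y = 1" and n: "length ls = n" and r: "arr_rank ls = r"
  shows "q ^ (n - r) * w ^ r * tutte ls (1 + v) y = rank_gf q w ls"
  unfolding tutte_def rank_gf_def sum_distrib_left n r
proof (rule sum.cong[OF refl])
  fix S assume "S \<in> Pow {..<n}"
  then have S: "S \<subseteq> {..<n}" "finite S" using finite_subset by auto
  define s where "s = form_rank ls S"
  \<comment> \<open>These four inequalities make all the natural-number differences below
    exact.\<close>
  have sc: "s \<le> card S" unfolding s_def using S(2) by (rule form_rank_le_card)
  have cn: "card S \<le> n" using S card_mono[of "{..<n}" S] by simp
  have sr: "s \<le> r" using form_rank_mono[of S "{..<n}" ls] S n r by (simp add: s_def arr_rank_def)
  have rn: "r \<le> n" using form_rank_le_card[of "{..<n}" ls] n r by (simp add: arr_rank_def)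
  have 1: "w ^ (r - s) * v ^ (r - s) = q ^ (r - s)"
    by (simp flip: power_mult_distrib add: wv)
  have "q * (y - 1) = 1 - q" by (simp add: right_diff_distrib qy)
  then have 2: "q ^ (card S - s) * (y - 1) ^ (card S - s) = (1 - q) ^ (card S - s)"
    by (simp flip: power_mult_distrib)
  have 3: "w ^ r = w ^ (r - s) * w ^ s" using sr by (simp flip: power_add)
  \<comment> \<open>Both exponents add up to \<open>n - s\<close>.\<close>
  have 4: "q ^ (n - r) * q ^ (r - s) = q ^ (n - card S) * q ^ (card S - s)"
    using sc cn sr rn by (simp flip: power_add)
  have "q ^ (n - r) * w ^ r * (v ^ (r - s) * (y - 1) ^ (card S - s)) =
    (q ^ (n - r) * (w ^ (r - s) * v ^ (r - s))) * (y - 1) ^ (card S - s) * w ^ s"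
    unfolding 3 by (simp only: mult_ac)
  also have "\<dots> = q ^ (n - card S) * (q ^ (card S - s) * (y - 1) ^ (card S - s)) * w ^ s"
    unfolding 1 4 by (simp only: mult_ac)
  finally show "q ^ (n - r) * w ^ r * ((1 + v - 1) ^ (r - form_rank ls S) *
      (y - 1) ^ (card S - form_rank ls S)) =
    q ^ (n - card S) * (1 - q) ^ (card S - form_rank ls S) * w ^ form_rank ls S"
    unfolding 2 s_def[symmetric] by simp
qed

theorem theorem4p12:
  fixes ls :: "cvec list" and n r m :: nat
  assumes "set ls \<subseteq> coord_space (r + m)"
    and "length ls = n"
    and "arr_rank ls = r"
  shows "Abs_fps (\<lambda>k. to_fract (Hilb (C_space (r + m) ls k)))
    = q_ser ^ (n - r) / ((1 - z_ser) * (1 - q_ser * z_ser) ^ m)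
      * tutte ls (1 + q_ser / (1 - q_ser * z_ser)) (fps_const (1 / q_var))"
proof -
  define w where "w = 1 - q_ser * z_ser"
  define T where "T = tutte ls (1 + q_ser / w) (fps_const (1 / q_var))"
  define u where "u = (1 - z_ser) * w ^ m"
  \<comment> \<open>Both constant coefficients are 1, so \<open>w\<close> and \<open>u\<close> are
    invertible and division by them is exact.\<close>
  have w0: "w $ 0 \<noteq> 0" by (simp add: w_def)
  have u0: "u $ 0 \<noteq> 0" by (simp add: u_def w_def)
  have "hilb_fps {..<r + m} ls * ((1 - z_ser) * w ^ (r + m)) = rank_gf q_ser w ls"
    using hilb_fps_eq_rank_gf[of "{..<r + m}" ls] assms(1) by (auto simp: w_def coord_space_def)
  also have "\<dots> = q_ser ^ (n - r) * w ^ r * T"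
    unfolding T_def using w0
    by (intro tutte_conv_rank_gf[OF _ _ assms(2,3), symmetric]) simp_all
  \<comment> \<open>Inserting \<open>u\<close> above and below exposes the common factor
    \<open>u * w ^ r\<close>, which equals \<open>(1 - z) * w ^ (r + m)\<close> and is then
    cancelled.\<close>
  also have "\<dots> = (q_ser ^ (n - r) / u * u) * w ^ r * T" using u0 by simp
  finally have "hilb_fps {..<r + m} ls * (u * w ^ r) = (q_ser ^ (n - r) / u * T) * (u * w ^ r)"
    by (simp add: u_def power_add mult_ac)
  moreover have "u * w ^ r \<noteq> 0" using u0 w0 by auto
  ultimately have "hilb_fps {..<r + m} ls = q_ser ^ (n - r) / u * T"
    using mult_right_cancel by blast
  then show ?thesis
    using assms(1) by (simp add: hilb_fps_def Hilb_C_space u_def w_def T_def)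
qed

end
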